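(* Let $f:K_{3,3}\to\mathbb{R}^{2}$ be a plane generic immersion of the complete bipartite graph $K_{3,3}$. Then \[ \sum_{\gamma\in\Gamma_{4}(K_{3,3})}c(f(\gamma))\equiv\sum_{\gamma\in\Gamma_{6}(K_{3,3})}c(f(\gamma))\equiv 1\pmod 2, \] where $\Gamma_k(K_{3,3})$ is the set of all $k$-cycles of $K_{3,3}$.
   Context: A finite graph $G$ is regarded as a topological space in the usual way. A $k$-cycle of $G$ is a subgraph with $k$ edges that is homeomorphic to a circle (cycles are unoriented subgraphs). A plane generic immersion of $G$ is an immersion $f:G\to\mathbb{R}^2$ (a continuous locally injective, piecewise smooth map) whose multiple points are only finitely many transversal double points between edges, i.e. between interior points of edges (possibly of the same edge); these double points are called crossings. For a subgraph $H$ of $G$, $c(f(H))$ denotes the number of crossings of the restriction $f|_H$. *)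

theory Defs
  imports "HOL-Analysis.Analysis" "HOL-Number_Theory.Cong"
begin

text \<open>Edges are meant to be two-element sets of vertices. The type does not enforce this, but it
  holds for \<open>K33\<close> and all its subgraphs, the only graphs used.\<close>

record 'v graph =
  verts :: "'v set"
  edges :: "'v set set"

definition complete_bipartite :: "('a::finite + 'b::finite) graph" where
  "complete_bipartite = \<lparr>verts = UNIV, edges = {{Inl a, Inr b} | a b. True}\<rparr>"

definition K33 :: "(3 + 3) graph" where
  "K33 = complete_bipartite"

definition subgraph_of :: "'v graph \<Rightarrow> 'v graph \<Rightarrow> bool" where
  "subgraph_of H G \<longleftrightarrow> verts H \<subseteq> verts G \<and> edges H \<subseteq> edges G \<and> \<Union>(edges H) \<subseteq> verts H"

text \<open>
  The topological space of a graph is its geometric realization as a one-dimensional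
  simplicial complex: the vertex \<open>v\<close> is the unit vector \<open>axis v 1\<close> and the edge
  \<open>{u, v}\<close> is the closed segment between two unit vectors. The realization of a subgraph
  is thereby a subspace of the realization of the graph.
\<close>

definition edge_path :: "'v \<Rightarrow> 'v \<Rightarrow> real \<Rightarrow> real ^ ('v::finite)" where
  "edge_path u v = linepath (axis u 1) (axis v 1)"

definition realization :: "'v graph \<Rightarrow> (real ^ ('v::finite)) set" where
  "realization G = (\<lambda>v. axis v 1) ` verts G \<union>
     (\<Union>e\<in>edges G. convex hull ((\<lambda>v. axis v 1) ` e))"

definition cycles :: "nat \<Rightarrow> ('v::finite) graph \<Rightarrow> 'v graph set" where
  "cycles k G = {H. subgraph_of H G \<and> card (edges H) = k \<and>
     realization H homeomorphic sphere (0 :: real ^ 2) 1}"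

definition locally_injective_on :: "'a::topological_space set \<Rightarrow> ('a \<Rightarrow> 'b) \<Rightarrow> bool" where
  "locally_injective_on S f \<longleftrightarrow> (\<forall>x\<in>S. \<exists>U. open U \<and> x \<in> U \<and> inj_on f (S \<inter> U))"

text \<open>
  \<open>C\<^sup>\<infinity>\<close> on a nondegenerate closed interval, with one-sided derivatives at its ends:
  \<open>D n\<close> is the \<open>n\<close>-th derivative.
\<close>

definition smooth_on_interval :: "real \<Rightarrow> real \<Rightarrow> (real \<Rightarrow> 'b::real_normed_vector) \<Rightarrow> bool" where
  "smooth_on_interval a b g \<longleftrightarrow> (\<exists>D. (\<forall>t\<in>{a..b}. D 0 t = g t) \<and>
     (\<forall>n. \<forall>t\<in>{a..b}. (D n has_vector_derivative D (Suc n) t) (at t within {a..b})))"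

text \<open>\<open>S\<close> is the finite set of break points.\<close>

definition piecewise_smooth_path :: "(real \<Rightarrow> 'b::real_normed_vector) \<Rightarrow> bool" where
  "piecewise_smooth_path g \<longleftrightarrow> continuous_on {0..1} g \<and>
     (\<exists>S. finite S \<and> (\<forall>a b. 0 \<le> a \<and> a < b \<and> b \<le> 1 \<and> {a<..<b} \<inter> S = {} \<longrightarrow>
        smooth_on_interval a b g))"

definition multiple_points :: "(real ^ 'v \<Rightarrow> real ^ 2) \<Rightarrow> ('v::finite) graph \<Rightarrow> (real ^ 2) set" where
  "multiple_points f G =
     {p. \<exists>x\<in>realization G. \<exists>y\<in>realization G. x \<noteq> y \<and> f x = p \<and> f y = p}"

text \<open>
  A transversal double point has exactly two preimages, both interior to edges (possibly to
  the same edge), and there the two branches have linearly independent velocities. Without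
  \<open>a \<noteq> b\<close>, independence of the set \<open>{a, b}\<close> would admit equal velocities.
\<close>

definition transversal_double_point ::
  "(real ^ 'v \<Rightarrow> real ^ 2) \<Rightarrow> ('v::finite) graph \<Rightarrow> real ^ 2 \<Rightarrow> bool" where
  "transversal_double_point f G p \<longleftrightarrow>
     (\<exists>u v s u' v' s' a b.
        {u, v} \<in> edges G \<and> s \<in> {0<..<1} \<and> {u', v'} \<in> edges G \<and> s' \<in> {0<..<1} \<and>
        edge_path u v s \<noteq> edge_path u' v' s' \<and>
        {x \<in> realization G. f x = p} = {edge_path u v s, edge_path u' v' s'} \<and>
        ((f \<circ> edge_path u v) has_vector_derivative a) (at s) \<and>
        ((f \<circ> edge_path u' v') has_vector_derivative b) (at s') \<and>
        a \<noteq> b \<and> independent {a, b})"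

definition plane_immersion :: "('v::finite) graph \<Rightarrow> (real ^ 'v \<Rightarrow> real ^ 2) \<Rightarrow> bool" where
  "plane_immersion G f \<longleftrightarrow>
     continuous_on (realization G) f \<and>
     locally_injective_on (realization G) f \<and>
     (\<forall>u v. {u, v} \<in> edges G \<longrightarrow> piecewise_smooth_path (f \<circ> edge_path u v))"

definition plane_generic_immersion :: "('v::finite) graph \<Rightarrow> (real ^ 'v \<Rightarrow> real ^ 2) \<Rightarrow> bool" where
  "plane_generic_immersion G f \<longleftrightarrow>
     plane_immersion G f \<and>
     finite (multiple_points f G) \<and>
     (\<forall>p\<in>multiple_points f G. transversal_double_point f G p)"

text \<open>
  For a generic immersion of a graph containing \<open>H\<close>, all multiple points of the
  restriction to \<open>H\<close> are crossings, and there are finitely many of them.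
\<close>

definition crossing_number :: "(real ^ 'v \<Rightarrow> real ^ 2) \<Rightarrow> ('v::finite) graph \<Rightarrow> nat" where
  "crossing_number f H = card (multiple_points f H)"

end

theory Submission
  imports Defs "HOL-Complex_Analysis.Complex_Analysis"
begin

text \<open>
  For disjoint edges \<open>e\<close> and \<open>e'\<close> the map \<open>(s, t) \<mapsto> f (e s) - f (e' t)\<close> on the unit square
  vanishes exactly at the crossings of the two edges, and by transversality every zero is
  nondegenerate. So its winding number along the boundary of the square has the parity of the
  number of these crossings. This winding number is a signed sum of four angles, each swept out by
  one of the edges as seen from an end point of the other.

  Fix a logarithm of \<open>f x - f y\<close> for all pairs of vertices, such that exchanging \<open>x\<close> and \<open>y\<close> adds
  half a turn. The angle swept out by an edge as seen from a vertex is then a difference of two such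
  logarithms plus an integer. In the sum over the 18 pairs of disjoint edges every one of these
  integers occurs twice, and the logarithms contribute one full turn for each of the 9 pairs
  \<open>{a b, a' b'}\<close> with \<open>a < a'\<close> and \<open>b < b'\<close>. Hence the number of crossings between disjoint edges
  is odd.

  A crossing of two disjoint edges lies on one 4-cycle and three 6-cycles, while every other
  crossing lies on an even number of cycles of either length. That a circle in the graph is one of
  the expected 4-cycles and 6-cycles holds because removing the midpoint of an edge at a vertex of
  degree one disconnects it, and because no circle properly contains another one.
\<close>

section \<open>Winding numbers along rectangles\<close>

text \<open>For \<open>F\<close> continuous and nonzero on the segment this is the change of a
  logarithm of \<open>F\<close>, measured in full turns. It is complex because the path is open: the
  real part is the angle swept out, the imaginary part records the change of modulus.\<close>

definition seg_wind :: "('a::real_normed_vector \<Rightarrow> complex) \<Rightarrow> 'a \<Rightarrow> 'a \<Rightarrow> complex" where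
  "seg_wind F a b = winding_number (F \<circ> linepath a b) 0"

text \<open>A continuous logarithm \<open>g\<close> turns the path into \<open>exp\<close> of a
  path, whose winding number about 0 is read off at its end points. \<open>S\<close> may exceed the
  segment, so that one logarithm can serve all sides of a rectangle.\<close>

lemma seg_wind_exp:
  assumes "continuous_on S g" "closed_segment a b \<subseteq> S" "\<And>x. x \<in> S \<Longrightarrow> F x = exp (g x)"
  shows "seg_wind F a b = (g b - g a) / (2 * of_real pi * \<i>)"
proof -
  have in_seg: "linepath a b t \<in> closed_segment a b" if "0 \<le> t" "t \<le> 1" for t
    using that by (auto simp: linepath_in_path)
  have "seg_wind F a b = winding_number (exp \<circ> (g \<circ> linepath a b)) 0"
    unfolding seg_wind_def
    by (rule winding_number_cong) (use assms in_seg in \<open>auto simp: subset_iff\<close>)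
  also have "\<dots> = (g b - g a) / (2 * of_real pi * \<i>)"
  proof (subst winding_number_compose_exp)
    show "path (g \<circ> linepath a b)"
      using assms(1,2) by (intro path_continuous_image) (auto intro: continuous_on_subset)
  qed (simp add: pathfinish_compose pathstart_compose)
  finally show ?thesis .
qed

text \<open>Convex sets are contractible, so a nowhere vanishing continuous function on one lifts
  through \<open>exp\<close>.\<close>

lemma convex_log:
  fixes F :: "'a::real_normed_vector \<Rightarrow> complex"
  assumes "convex S" "continuous_on S F" "\<And>x. x \<in> S \<Longrightarrow> F x \<noteq> 0"
  obtains g where "continuous_on S g" "\<And>x. x \<in> S \<Longrightarrow> F x = exp (g x)"
  using continuous_logarithm_on_contractible[OF assms(2) convex_imp_contractible[OF assms(1)] assms(3)]
  by blast

lemma seg_wind_split: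
  assumes "continuous_on (closed_segment a b) F" "\<And>x. x \<in> closed_segment a b \<Longrightarrow> F x \<noteq> 0"
    and m: "m \<in> closed_segment a b"
  shows "seg_wind F a b = seg_wind F a m + seg_wind F m b"
proof -
  obtain g where g: "continuous_on (closed_segment a b) g" "\<And>x. x \<in> closed_segment a b \<Longrightarrow> F x = exp (g x)"
    using convex_log[OF convex_closed_segment assms(1,2)] by blast
  have "closed_segment a m \<subseteq> closed_segment a b" "closed_segment m b \<subseteq> closed_segment a b"
    using m by (simp_all add: subset_closed_segment)
  then show ?thesis
    by (simp add: seg_wind_exp[OF g(1) _ g(2)] diff_divide_distrib)
qed

lemma seg_wind_reverse:
  assumes "continuous_on (closed_segment a b) F" "\<And>x. x \<in> closed_segment a b \<Longrightarrow> F x \<noteq> 0"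
  shows "seg_wind F b a = - seg_wind F a b"
proof -
  obtain g where g: "continuous_on (closed_segment a b) g" "\<And>x. x \<in> closed_segment a b \<Longrightarrow> F x = exp (g x)"
    using convex_log[OF convex_closed_segment assms(1,2)] by blast
  then show ?thesis
    by (simp add: seg_wind_exp[OF g(1) _ g(2)] closed_segment_commute minus_divide_left)
qed

lemma seg_wind_uminus:
  assumes "continuous_on (closed_segment a b) F" "\<And>x. x \<in> closed_segment a b \<Longrightarrow> F x \<noteq> 0"
  shows "seg_wind (\<lambda>x. - F x) a b = seg_wind F a b"
proof -
  obtain g where g: "continuous_on (closed_segment a b) g" "\<And>x. x \<in> closed_segment a b \<Longrightarrow> F x = exp (g x)"
    using convex_log[OF convex_closed_segment assms(1,2)] by blast
  \<comment> \<open>Adding \<open>pi * \<i>\<close> to a logarithm of \<open>F\<close> gives a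
    logarithm of \<open>- F\<close>; the shift cancels between the end points.\<close>
  have "seg_wind (\<lambda>x. - F x) a b = ((g b + of_real pi * \<i>) - (g a + of_real pi * \<i>)) / (2 * of_real pi * \<i>)"
    by (rule seg_wind_exp[where S = "closed_segment a b"])
       (use g in \<open>auto simp: exp_add mult.commute intro!: continuous_intros\<close>)
  then show ?thesis
    by (simp add: seg_wind_exp[OF g(1) _ g(2)])
qed

lemma seg_wind_times:
  assumes "continuous_on (closed_segment a b) F" "\<And>x. x \<in> closed_segment a b \<Longrightarrow> F x \<noteq> 0"
    and "continuous_on (closed_segment a b) G" "\<And>x. x \<in> closed_segment a b \<Longrightarrow> G x \<noteq> 0"
  shows "seg_wind (\<lambda>x. F x * G x) a b = seg_wind F a b + seg_wind G a b"
proof -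
  obtain g where g: "continuous_on (closed_segment a b) g" "\<And>x. x \<in> closed_segment a b \<Longrightarrow> F x = exp (g x)"
    using convex_log[OF convex_closed_segment assms(1,2)] by blast
  obtain h where h: "continuous_on (closed_segment a b) h" "\<And>x. x \<in> closed_segment a b \<Longrightarrow> G x = exp (h x)"
    using convex_log[OF convex_closed_segment assms(3,4)] by blast
  have "seg_wind (\<lambda>x. F x * G x) a b = ((g b + h b) - (g a + h a)) / (2 * of_real pi * \<i>)"
    by (rule seg_wind_exp[where S = "closed_segment a b"])
       (use g h in \<open>auto simp: exp_add intro!: continuous_intros\<close>)
  then show ?thesis
    by (simp add: seg_wind_exp[OF g(1) _ g(2)] seg_wind_exp[OF h(1) _ h(2)] diff_divide_distrib add_divide_distrib)
qed

lemma seg_wind_cong: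
  assumes "\<And>x. x \<in> closed_segment a b \<Longrightarrow> F x = G x"
  shows "seg_wind F a b = seg_wind G a b"
  unfolding seg_wind_def
  by (rule winding_number_cong) (use assms in \<open>auto simp: linepath_in_path\<close>)

lemma exp_seg_wind:
  assumes "continuous_on (closed_segment a b) F" "\<And>x. x \<in> closed_segment a b \<Longrightarrow> F x \<noteq> 0"
  shows "F b = exp (2 * of_real pi * \<i> * seg_wind F a b) * F a"
proof -
  obtain g where g: "continuous_on (closed_segment a b) g" "\<And>x. x \<in> closed_segment a b \<Longrightarrow> F x = exp (g x)"
    using convex_log[OF convex_closed_segment assms(1,2)] by blast
  then show ?thesis
    by (simp add: seg_wind_exp[OF g(1) _ g(2)] exp_diff)
qed

section \<open>Change of argument along the boundary of a rectangle\<close>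

text \<open>The four sides of the rectangle from \<open>Complex a c\<close> to
  \<open>Complex b d\<close>, traversed counterclockwise. Keeping them as four summands makes it
  easy to cut a rectangle in two and to evaluate each side separately.\<close>

definition box_wind :: "(complex \<Rightarrow> complex) \<Rightarrow> real \<Rightarrow> real \<Rightarrow> real \<Rightarrow> real \<Rightarrow> complex" where
  "box_wind F a b c d =
     seg_wind F (Complex a c) (Complex b c) + seg_wind F (Complex b c) (Complex b d) +
     seg_wind F (Complex b d) (Complex a d) + seg_wind F (Complex a d) (Complex a c)"

definition box_sides :: "real \<Rightarrow> real \<Rightarrow> real \<Rightarrow> real \<Rightarrow> complex set" where
  "box_sides a b c d =
     closed_segment (Complex a c) (Complex b c) \<union> closed_segment (Complex b c) (Complex b d) \<union>
     closed_segment (Complex b d) (Complex a d) \<union> closed_segment (Complex a d) (Complex a c)"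

lemma box_sides_segments:
  fixes a b c d :: real
  shows
  "closed_segment (Complex a c) (Complex b c) \<subseteq> box_sides a b c d"
  "closed_segment (Complex b c) (Complex b d) \<subseteq> box_sides a b c d"
  "closed_segment (Complex b d) (Complex a d) \<subseteq> box_sides a b c d"
  "closed_segment (Complex a d) (Complex a c) \<subseteq> box_sides a b c d"
  by (auto simp: box_sides_def)

text \<open>With one single-valued logarithm on all four sides the differences at the corners
  telescope.\<close>

lemma box_wind_eq_0:
  assumes "continuous_on (box_sides a b c d) g"
    and "\<And>x. x \<in> box_sides a b c d \<Longrightarrow> F x = exp (g x)"
  shows "box_wind F a b c d = 0"
proof -
  show ?thesis
    unfolding box_wind_def
    by (simp add: seg_wind_exp[OF assms(1) box_sides_segments(1) assms(2)]
        seg_wind_exp[OF assms(1) box_sides_segments(2) assms(2)]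
        seg_wind_exp[OF assms(1) box_sides_segments(3) assms(2)]
        seg_wind_exp[OF assms(1) box_sides_segments(4) assms(2)] diff_divide_distrib)
qed

lemma box_wind_times:
  assumes "continuous_on (box_sides a b c d) F" "\<And>x. x \<in> box_sides a b c d \<Longrightarrow> F x \<noteq> 0"
    and "continuous_on (box_sides a b c d) G" "\<And>x. x \<in> box_sides a b c d \<Longrightarrow> G x \<noteq> 0"
  shows "box_wind (\<lambda>x. F x * G x) a b c d = box_wind F a b c d + box_wind G a b c d"
proof -
  have split: "seg_wind (\<lambda>x. F x * G x) u v = seg_wind F u v + seg_wind G u v"
    if "closed_segment u v \<subseteq> box_sides a b c d" for u v
    using that by (intro seg_wind_times continuous_on_subset[OF assms(1)] continuous_on_subset[OF assms(3)] assms(2,4)) auto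
  show ?thesis
    by (simp add: box_wind_def split box_sides_segments)
qed

lemma box_wind_cong:
  assumes "\<And>x. x \<in> box_sides a b c d \<Longrightarrow> F x = G x"
  shows "box_wind F a b c d = box_wind G a b c d"
  unfolding box_wind_def
  by (intro arg_cong2[where f = "(+)"] seg_wind_cong assms) (auto simp: box_sides_def)

lemma box_sides_iff:
  assumes "a \<le> b" "c \<le> d"
  shows "z \<in> box_sides a b c d \<longleftrightarrow> z \<in> cbox (Complex a c) (Complex b d) \<and> (Re z \<in> {a,b} \<or> Im z \<in> {c,d})"
  using assms
  by (auto simp: box_sides_def closed_segment_same_Re closed_segment_same_Im
      closed_segment_eq_real_ivl in_cbox_complex_iff)

lemma box_sides_subset: "a \<le> b \<Longrightarrow> c \<le> d \<Longrightarrow> box_sides a b c d \<subseteq> cbox (Complex a c) (Complex b d)"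
  by (auto simp: box_sides_iff)

lemma box_wind_zero_free:
  assumes "a \<le> b" "c \<le> d" "continuous_on (cbox (Complex a c) (Complex b d)) F"
    "\<And>z. z \<in> cbox (Complex a c) (Complex b d) \<Longrightarrow> F z \<noteq> 0"
  shows "box_wind F a b c d = 0"
proof -
  obtain g where g: "continuous_on (cbox (Complex a c) (Complex b d)) g"
    "\<And>z. z \<in> cbox (Complex a c) (Complex b d) \<Longrightarrow> F z = exp (g z)"
    using convex_log[OF convex_box(1) assms(3,4)] by blast
  show ?thesis
    by (rule box_wind_eq_0[where g = g])
       (use g box_sides_subset[OF assms(1,2)] in \<open>auto intro: continuous_on_subset\<close>)
qed

text \<open>The two long sides split at \<open>m\<close>, and the new common side is traversed once
  in each direction, so its contributions cancel.\<close>

lemma box_wind_split_Re: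
  assumes "a \<le> m" "m \<le> b" "c \<le> d" "continuous_on (cbox (Complex a c) (Complex b d)) F"
    and nz: "\<And>z. z \<in> box_sides a m c d \<union> box_sides m b c d \<Longrightarrow> F z \<noteq> 0"
  shows "box_wind F a b c d = box_wind F a m c d + box_wind F m b c d"
proof -
  let ?S = "box_sides a m c d \<union> box_sides m b c d"
  have "?S \<subseteq> cbox (Complex a c) (Complex b d)"
    using assms(1-3) by (auto simp: box_sides_iff in_cbox_complex_iff)
  then have cont: "continuous_on ?S F"
    using assms(4) continuous_on_subset by blast
  have split: "seg_wind F u v = seg_wind F u w + seg_wind F w v"
    if "w \<in> closed_segment u v" "closed_segment u v \<subseteq> ?S" for u v w
    using that nz by (intro seg_wind_split continuous_on_subset[OF cont]) auto
  have "seg_wind F (Complex a c) (Complex b c) =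
      seg_wind F (Complex a c) (Complex m c) + seg_wind F (Complex m c) (Complex b c)"
    by (rule split) (use assms(1-3) in \<open>auto simp: box_sides_iff closed_segment_same_Im
      closed_segment_eq_real_ivl in_cbox_complex_iff\<close>)
  moreover have "seg_wind F (Complex b d) (Complex a d) =
      seg_wind F (Complex b d) (Complex m d) + seg_wind F (Complex m d) (Complex a d)"
    by (rule split) (use assms(1-3) in \<open>auto simp: box_sides_iff closed_segment_same_Im
      closed_segment_eq_real_ivl in_cbox_complex_iff\<close>)
  moreover have "seg_wind F (Complex m d) (Complex m c) = - seg_wind F (Complex m c) (Complex m d)"
    using nz box_sides_segments(2)[where a = a and b = m and c = c and d = d]
    by (intro seg_wind_reverse continuous_on_subset[OF cont]) auto
  ultimately show ?thesis
    by (simp add: box_wind_def)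
qed

lemma box_wind_split_Im:
  assumes "c \<le> m" "m \<le> d" "a \<le> b" "continuous_on (cbox (Complex a c) (Complex b d)) F"
    and nz: "\<And>z. z \<in> box_sides a b c m \<union> box_sides a b m d \<Longrightarrow> F z \<noteq> 0"
  shows "box_wind F a b c d = box_wind F a b c m + box_wind F a b m d"
proof -
  let ?S = "box_sides a b c m \<union> box_sides a b m d"
  have "?S \<subseteq> cbox (Complex a c) (Complex b d)"
    using assms(1-3) by (auto simp: box_sides_iff in_cbox_complex_iff)
  then have cont: "continuous_on ?S F"
    using assms(4) continuous_on_subset by blast
  have split: "seg_wind F u v = seg_wind F u w + seg_wind F w v"
    if "w \<in> closed_segment u v" "closed_segment u v \<subseteq> ?S" for u v w
    using that nz by (intro seg_wind_split continuous_on_subset[OF cont]) auto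
  have "seg_wind F (Complex b c) (Complex b d) =
      seg_wind F (Complex b c) (Complex b m) + seg_wind F (Complex b m) (Complex b d)"
    by (rule split) (use assms(1-3) in \<open>auto simp: box_sides_iff closed_segment_same_Re
      closed_segment_eq_real_ivl in_cbox_complex_iff\<close>)
  moreover have "seg_wind F (Complex a d) (Complex a c) =
      seg_wind F (Complex a d) (Complex a m) + seg_wind F (Complex a m) (Complex a c)"
    by (rule split) (use assms(1-3) in \<open>auto simp: box_sides_iff closed_segment_same_Re
      closed_segment_eq_real_ivl in_cbox_complex_iff\<close>)
  moreover have "seg_wind F (Complex a m) (Complex b m) = - seg_wind F (Complex b m) (Complex a m)"
    using nz box_sides_segments(3)[where a = a and b = b and c = c and d = m]
    by (intro seg_wind_reverse continuous_on_subset[OF cont]) auto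
  ultimately show ?thesis
    by (simp add: box_wind_def)
qed

section \<open>The local contribution of a nondegenerate zero\<close>

text \<open>The odd symmetry makes opposite sides contribute equally, and two consecutive sides join
  antipodal points, so together they turn by half an odd integer.\<close>

lemma box_wind_linear:
  fixes z :: complex
  assumes "linear L" "inj L" "r > 0"
  shows "\<exists>n::int. odd n \<and>
    box_wind (\<lambda>w. L (w - z)) (Re z - r) (Re z + r) (Im z - r) (Im z + r) = of_int n"
proof -
  define G where "G w = L (w - z)" for w
  \<comment> \<open>\<open>p\<close>, \<open>q\<close>, \<open>p'\<close>, \<open>q'\<close> are the
    corners in counterclockwise order; a prime marks the reflection in the centre
    \<open>z\<close>.\<close>
  define p where "p = Complex (Re z - r) (Im z - r)"
  define q where "q = Complex (Re z + r) (Im z - r)"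
  define p' where "p' = Complex (Re z + r) (Im z + r)"
  define q' where "q' = Complex (Re z - r) (Im z + r)"
  interpret L: linear L by fact
  have cont: "continuous_on S G" for S
    unfolding G_def by (rule linear_continuous_on_compose[OF _ assms(1)]) (intro continuous_intros)
  have nz: "G w \<noteq> 0" if "w \<noteq> z" for w
    using that L.inj_iff_eq_0 assms(2) unfolding G_def by (metis right_minus_eq)
  have nzpq: "G w \<noteq> 0" if "w \<in> closed_segment p q" for w
    using that assms(3) by (intro nz) (auto simp: p_def q_def closed_segment_same_Im closed_segment_eq_real_ivl)
  have nzqp: "G w \<noteq> 0" if "w \<in> closed_segment q p'" for w
    using that assms(3) by (intro nz) (auto simp: p'_def q_def closed_segment_same_Re closed_segment_eq_real_ivl)
  have odd_G: "G (2 * z - w) = - G w" for w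
    unfolding G_def by (simp add: algebra_simps flip: L.neg)
  have reflect: "seg_wind G (2 * z - u) (2 * z - v) = seg_wind (\<lambda>w. - G w) u v" for u v
    unfolding seg_wind_def
  proof (rule winding_number_cong)
    fix t :: real
    have "linepath (2 * z - u) (2 * z - v) t = 2 * z - linepath u v t"
      by (simp add: linepath_def algebra_simps scaleR_conv_of_real)
    then show "(G \<circ> linepath (2 * z - u) (2 * z - v)) t = ((\<lambda>w. - G w) \<circ> linepath u v) t"
      by (simp add: odd_G)
  qed
  have eqs: "p' = 2 * z - p" "q' = 2 * z - q"
    by (simp_all add: p_def p'_def q_def q'_def complex_eq_iff)
  have p2: "p = 2 * z - p'"
    by (simp add: eqs)
  have s3: "seg_wind G p' q' = seg_wind G p q"
    unfolding eqs reflect by (rule seg_wind_uminus[OF cont nzpq])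
  have s4: "seg_wind G q' p = seg_wind G q p'"
    unfolding eqs(2) by (subst p2, unfold reflect) (rule seg_wind_uminus[OF cont nzqp])
  define w where "w = seg_wind G p q + seg_wind G q p'"
  have "G p' = exp (2 * of_real pi * \<i> * w) * G p"
    using exp_seg_wind[OF cont nzpq] exp_seg_wind[OF cont nzqp]
    by (simp add: w_def exp_add ring_distribs)
  moreover have "G p' = - G p" "G p \<noteq> 0"
    using odd_G[of p] nzpq[of p] eqs by auto
  ultimately have "exp (2 * of_real pi * \<i> * w) = -1"
    by (metis mult_cancel_right mult_minus1)
  then have "exp (2 * of_real pi * \<i> * w) = exp (of_real pi * \<i>)"
    by (simp add: mult.commute)
  then obtain n :: int where "2 * of_real pi * \<i> * w = of_real pi * \<i> + (of_int (2 * n) * pi) * \<i>"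
    unfolding exp_eq by auto
  then have "(of_real pi * \<i>) * (2 * w) = (of_real pi * \<i>) * (of_int (2 * n + 1) :: complex)"
    by (simp add: algebra_simps)
  then have "2 * w = of_int (2 * n + 1)"
    by (subst (asm) mult_left_cancel) auto
  moreover have "box_wind G (Re z - r) (Re z + r) (Im z - r) (Im z + r) = 2 * w"
    unfolding box_wind_def
    using s3 s4 by (simp add: w_def flip: p_def q_def p'_def q'_def)
  ultimately show ?thesis
    unfolding G_def[symmetric] by (intro exI[of _ "2 * n + 1"]) auto
qed

text \<open>Rouche's argument: the quotient \<open>F / G\<close> has distance less than 1 from 1, so
  it stays in the right half plane, where the principal logarithm is continuous. Hence the quotient
  contributes nothing.\<close>

lemma box_wind_close:
  assumes contF: "continuous_on (box_sides a b c d) F" and contG: "continuous_on (box_sides a b c d) G"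
    and close: "\<And>w. w \<in> box_sides a b c d \<Longrightarrow> norm (F w - G w) < norm (G w)"
  shows "box_wind F a b c d = box_wind G a b c d"
proof -
  define K where "K = (\<lambda>w. F w / G w)"
  have nzG: "G w \<noteq> 0" if "w \<in> box_sides a b c d" for w
    using close[OF that] by auto
  have contK: "continuous_on (box_sides a b c d) K"
    unfolding K_def using contF contG nzG by (intro continuous_intros) auto
  have RK: "0 < Re (K w)" if "w \<in> box_sides a b c d" for w
  proof -
    have "K w - 1 = (F w - G w) / G w"
      using nzG[OF that] by (simp add: K_def divide_simps)
    then have "norm (K w - 1) < 1"
      using close[OF that] nzG[OF that] by (simp add: norm_divide)
    then show ?thesis
      using abs_Re_le_cmod[of "K w - 1"] by simp
  qed
  have nzK: "K w \<noteq> 0" if "w \<in> box_sides a b c d" for w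
    using RK[OF that] by auto
  have "continuous_on (box_sides a b c d) (\<lambda>w. Ln (K w))"
    by (rule continuous_on_Ln'[OF contK]) (use RK in \<open>force simp: complex_nonpos_Reals_iff\<close>)
  then have "box_wind K a b c d = 0"
    by (rule box_wind_eq_0) (use nzK in auto)
  then have "box_wind (\<lambda>w. G w * K w) a b c d = box_wind G a b c d"
    using box_wind_times[OF contG nzG contK nzK] by simp
  moreover have "box_wind (\<lambda>w. G w * K w) a b c d = box_wind F a b c d"
    by (rule box_wind_cong) (use nzG in \<open>auto simp: K_def\<close>)
  ultimately show ?thesis by simp
qed

text \<open>An injective derivative satisfies \<open>B * norm x \<le> norm (L x)\<close>, while near
  \<open>z\<close> the remainder is at most half of that bound. On small squares \<open>F\<close>
  may therefore be replaced by its linear part.\<close>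

lemma box_wind_small:
  fixes F :: "complex \<Rightarrow> complex"
  assumes der: "(F has_derivative L) (at z)" and inj: "inj L" and F0: "F z = 0"
    and contF: "continuous_on U F" and U: "open U" "z \<in> U"
  shows "\<exists>e>0. \<forall>r. 0 < r \<and> r < e \<longrightarrow> (\<exists>n::int. odd n \<and>
    box_wind F (Re z - r) (Re z + r) (Im z - r) (Im z + r) = of_int n)"
proof -
  have lin: "linear L" using der by (simp add: has_derivative_linear)
  obtain B where B: "B > 0" "\<And>x. B * norm x \<le> norm (L x)"
    using linear_inj_bounded_below_pos[OF lin inj] by blast
  have "\<exists>d>0. \<forall>y. norm (y - z) < d \<longrightarrow> norm (F y - F z - L (y - z)) \<le> B / 2 * norm (y - z)"
    using der B(1) unfolding has_derivative_at_alt by (meson half_gt_zero)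
  then obtain d where d: "d > 0"
    "\<And>y. norm (y - z) < d \<Longrightarrow> norm (F y - L (y - z)) \<le> B / 2 * norm (y - z)"
    using F0 by auto
  obtain d' where d': "d' > 0" "ball z d' \<subseteq> U"
    using openE[OF U] by blast
  \<comment> \<open>A boundary point of the square of half side \<open>r < e\<close> has distance at
    most \<open>2 * r\<close> from \<open>z\<close>, which is below both \<open>d\<close> and
    \<open>d'\<close>.\<close>
  define e where "e = min d d' / 2"
  have "e > 0" using d(1) d'(1) by (simp add: e_def)
  moreover have "\<exists>n::int. odd n \<and>
    box_wind F (Re z - r) (Re z + r) (Im z - r) (Im z + r) = of_int n" if "0 < r" "r < e" for r
  proof -
    let ?S = "box_sides (Re z - r) (Re z + r) (Im z - r) (Im z + r)"
    have S: "w \<noteq> z \<and> norm (w - z) < d \<and> norm (w - z) < d'" if w: "w \<in> ?S" for w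
    proof -
      have "\<bar>Re (w - z)\<bar> \<le> r" "\<bar>Im (w - z)\<bar> \<le> r" "\<bar>Re (w - z)\<bar> = r \<or> \<bar>Im (w - z)\<bar> = r"
        using w \<open>0 < r\<close> by (auto simp: box_sides_iff in_cbox_complex_iff)
      moreover have "2 * e \<le> d" "2 * e \<le> d'" by (auto simp: e_def)
      moreover note cmod_le[of "w - z"] \<open>r < e\<close> \<open>0 < r\<close>
      ultimately show ?thesis by auto
    qed
    have "box_wind F (Re z - r) (Re z + r) (Im z - r) (Im z + r) =
      box_wind (\<lambda>w. L (w - z)) (Re z - r) (Re z + r) (Im z - r) (Im z + r)"
    proof (rule box_wind_close)
      show "continuous_on ?S F"
      proof (rule continuous_on_subset[OF contF], rule subsetI)
        fix w assume "w \<in> ?S"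
        then have "w \<in> ball z d'"
          using S[of w] by (simp add: dist_norm norm_minus_commute)
        with d'(2) show "w \<in> U" by blast
      qed
      show "continuous_on ?S (\<lambda>w. L (w - z))"
        by (rule linear_continuous_on_compose[OF _ lin]) (intro continuous_intros)
      fix w assume w: "w \<in> ?S"
      have "norm (F w - L (w - z)) \<le> B / 2 * norm (w - z)"
        using d(2) S[OF w] by blast
      also have "\<dots> < B * norm (w - z)"
        using S[OF w] B(1) by simp
      also have "\<dots> \<le> norm (L (w - z))" by (rule B(2))
      finally show "norm (F w - L (w - z)) < norm (L (w - z))" .
    qed
    then show ?thesis
      using box_wind_linear[OF lin inj \<open>0 < r\<close>, of z] by simp
  qed
  ultimately show ?thesis by blast
qed

section \<open>Counting zeros in a rectangle modulo two\<close>

text \<open>Two vertical and two horizontal cuts isolate a small square around the zero. The four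
  remaining pieces are free of zeros and contribute 0.\<close>

lemma box_wind_single_zero:
  assumes "z \<in> box (Complex a c) (Complex b d)"
    and cont: "continuous_on (cbox (Complex a c) (Complex b d)) F"
    and zeros: "{w \<in> cbox (Complex a c) (Complex b d). F w = 0} = {z}"
    and der: "(F has_derivative L) (at z)" and inj: "inj L"
  shows "\<exists>n::int. odd n \<and> box_wind F a b c d = of_int n"
proof -
  have z: "a < Re z" "Re z < b" "c < Im z" "Im z < d"
    using assms(1) by (auto simp: in_box_complex_iff)
  have "F z = 0" using zeros by auto
  obtain e where e: "e > 0" "\<And>r. 0 < r \<and> r < e \<Longrightarrow> (\<exists>n::int. odd n \<and>
    box_wind F (Re z - r) (Re z + r) (Im z - r) (Im z + r) = of_int n)"
    using box_wind_small[OF der inj \<open>F z = 0\<close> continuous_on_subset[OF cont box_subset_cbox] open_box assms(1)]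
    by blast
  \<comment> \<open>Half of the minimum keeps the square strictly inside the rectangle and its half
    side strictly below \<open>e\<close>.\<close>
  define r where "r = Min {e, Re z - a, b - Re z, Im z - c, d - Im z} / 2"
  have "r > 0" using e z by (auto simp: r_def)
  moreover have "2 * r \<le> e" "2 * r \<le> Re z - a" "2 * r \<le> b - Re z" "2 * r \<le> Im z - c" "2 * r \<le> d - Im z"
    by (auto simp: r_def)
  ultimately have r: "r > 0" "r < e" "a < Re z - r" "Re z + r < b" "c < Im z - r" "Im z + r < d"
    by linarith+
  have nz: "F w = 0 \<longleftrightarrow> w = z" if "a \<le> Re w" "Re w \<le> b" "c \<le> Im w" "Im w \<le> d" for w
    using that zeros by (auto simp: in_cbox_complex_iff)
  have "box_wind F a b c d = box_wind F a (Re z - r) c d + box_wind F (Re z - r) b c d"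
    by (rule box_wind_split_Re)
       (use r z in \<open>auto intro!: cont simp: nz box_sides_iff in_cbox_complex_iff\<close>)
  also have "box_wind F (Re z - r) b c d = box_wind F (Re z - r) (Re z + r) c d + box_wind F (Re z + r) b c d"
    by (rule box_wind_split_Re)
       (use r z in \<open>auto intro!: continuous_on_subset[OF cont] simp: nz box_sides_iff in_cbox_complex_iff\<close>)
  also have "box_wind F (Re z - r) (Re z + r) c d =
      box_wind F (Re z - r) (Re z + r) c (Im z - r) + box_wind F (Re z - r) (Re z + r) (Im z - r) d"
    by (rule box_wind_split_Im)
       (use r z in \<open>auto intro!: continuous_on_subset[OF cont] simp: nz box_sides_iff in_cbox_complex_iff\<close>)
  also have "box_wind F (Re z - r) (Re z + r) (Im z - r) d =
      box_wind F (Re z - r) (Re z + r) (Im z - r) (Im z + r) + box_wind F (Re z - r) (Re z + r) (Im z + r) d"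
    by (rule box_wind_split_Im)
       (use r z in \<open>auto intro!: continuous_on_subset[OF cont] simp: nz box_sides_iff in_cbox_complex_iff\<close>)
  also have "box_wind F a (Re z - r) c d = 0"
    by (rule box_wind_zero_free)
       (use r z in \<open>auto intro!: continuous_on_subset[OF cont] simp: nz in_cbox_complex_iff\<close>)
  also have "box_wind F (Re z + r) b c d = 0"
    by (rule box_wind_zero_free)
       (use r z in \<open>auto intro!: continuous_on_subset[OF cont] simp: nz in_cbox_complex_iff\<close>)
  also have "box_wind F (Re z - r) (Re z + r) c (Im z - r) = 0"
    by (rule box_wind_zero_free)
       (use r z in \<open>auto intro!: continuous_on_subset[OF cont] simp: nz in_cbox_complex_iff\<close>)
  also have "box_wind F (Re z - r) (Re z + r) (Im z + r) d = 0"
    by (rule box_wind_zero_free)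
       (use r z in \<open>auto intro!: continuous_on_subset[OF cont] simp: nz in_cbox_complex_iff\<close>)
  finally show ?thesis
    using e(2)[of r] r by simp
qed

text \<open>Induction on the number of zeros: two zeros are separated by a vertical cut, and
  parities add. Injectivity of \<open>Re\<close> on the zeros guarantees that vertical cuts suffice
  until each piece has at most one zero.\<close>

lemma box_wind_parity:
  fixes F :: "complex \<Rightarrow> complex"
  assumes "c \<le> d" "a \<le> b" "continuous_on (cbox (Complex a c) (Complex b d)) F"
    and "finite {z \<in> cbox (Complex a c) (Complex b d). F z = 0}"
    and "{z \<in> cbox (Complex a c) (Complex b d). F z = 0} \<subseteq> box (Complex a c) (Complex b d)"
    and "inj_on Re {z \<in> cbox (Complex a c) (Complex b d). F z = 0}"
    and "\<And>z. z \<in> cbox (Complex a c) (Complex b d) \<Longrightarrow> F z = 0 \<Longrightarrow>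
           \<exists>L. (F has_derivative L) (at z) \<and> inj L"
  shows "\<exists>n::int. box_wind F a b c d = of_int n \<and>
           (even n \<longleftrightarrow> even (card {z \<in> cbox (Complex a c) (Complex b d). F z = 0}))"
  using assms
proof (induction "card {z \<in> cbox (Complex a c) (Complex b d). F z = 0}" arbitrary: a b rule: less_induct)
  case (less a b)
  define Z where "Z a b = {z \<in> cbox (Complex a c) (Complex b d). F z = 0}" for a b
  note IH = less.hyps[folded Z_def]
  note P = less.prems[folded Z_def]
  consider "Z a b = {}" | z where "Z a b = {z}" | z z' where "z \<in> Z a b" "z' \<in> Z a b" "z \<noteq> z'"
    by blast
  then have "\<exists>n::int. box_wind F a b c d = of_int n \<and> (even n \<longleftrightarrow> even (card (Z a b)))"
  proof cases
    case 1
    then have "box_wind F a b c d = 0"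
      by (intro box_wind_zero_free P) (auto simp: Z_def)
    with 1 show ?thesis by (intro exI[of _ 0]) simp
  next
    case (2 z)
    then obtain L where "(F has_derivative L) (at z)" "inj L"
      using P(7)[of z] by (auto simp: Z_def)
    then have "\<exists>n::int. odd n \<and> box_wind F a b c d = of_int n"
      by (intro box_wind_single_zero[of z]) (use 2 P(3,5) in \<open>auto simp: Z_def\<close>)
    with 2 show ?thesis by auto
  next
    case (3 z z')
    have "\<exists>x y. x \<in> Z a b \<and> y \<in> Z a b \<and> Re x < Re y"
      using 3 inj_onD[OF P(6), of z z'] by (metis linorder_neqE)
    then obtain x y where xy: "x \<in> Z a b" "y \<in> Z a b" "Re x < Re y" by blast
    \<comment> \<open>Zeros occupy only finitely many abscissae, so the cut can avoid all of them.
      Each piece keeps one of \<open>x\<close>, \<open>y\<close>, hence both have fewer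
      zeros.\<close>
    have "infinite ({Re x<..<Re y} - Re ` Z a b)"
      using xy P(4) by (simp add: infinite_Ioo)
    then obtain m where m: "Re x < m" "m < Re y" "m \<notin> Re ` Z a b"
      by (metis Diff_iff finite.emptyI greaterThanLessThan_iff equals0I)
    have ab: "a < Re x" "Re y < b" using xy P(5) by (auto simp: in_box_complex_iff)
    have un: "Z a b = Z a m \<union> Z m b"
      using m ab by (auto simp: Z_def in_cbox_complex_iff)
    have disj: "Z a m \<inter> Z m b = {}"
      using m(3) ab m by (force simp: Z_def in_cbox_complex_iff)
    have "x \<in> Z a m" "x \<notin> Z m b" "y \<in> Z m b" "y \<notin> Z a m"
      using xy m by (auto simp: Z_def in_cbox_complex_iff)
    then have psub: "Z a m \<subset> Z a b" "Z m b \<subset> Z a b" using un by auto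
    then have fin: "finite (Z a m)" "finite (Z m b)" and lt: "card (Z a m) < card (Z a b)" "card (Z m b) < card (Z a b)"
      using P(4) by (auto intro: psubset_card_mono finite_subset)
    have sub: "cbox (Complex a c) (Complex m d) \<subseteq> cbox (Complex a c) (Complex b d)"
      "cbox (Complex m c) (Complex b d) \<subseteq> cbox (Complex a c) (Complex b d)"
      using m ab by (auto simp: in_cbox_complex_iff)
    have inner: "a < Re w" "Re w < b" "c < Im w" "Im w < d" "Re w \<noteq> m" if "w \<in> Z a b" for w
      using P(5) m(3) that by (auto simp: in_box_complex_iff)
    have "\<exists>n::int. box_wind F a m c d = of_int n \<and> (even n \<longleftrightarrow> even (card (Z a m)))"
    proof (rule IH)
      show "card (Z a m) < card (Z a b)" "finite (Z a m)" by fact+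
      show "Z a m \<subseteq> box (Complex a c) (Complex m d)"
      proof
        fix w assume w: "w \<in> Z a m"
        then have "w \<in> Z a b" "Re w \<le> m" using psub by (auto simp: Z_def in_cbox_complex_iff)
        with inner[of w] show "w \<in> box (Complex a c) (Complex m d)" by (auto simp: in_box_complex_iff)
      qed
    qed (use P m ab psub sub in \<open>auto intro: continuous_on_subset inj_on_subset\<close>)
    then obtain n1 :: int where n1: "box_wind F a m c d = of_int n1" "even n1 \<longleftrightarrow> even (card (Z a m))" by blast
    have "\<exists>n::int. box_wind F m b c d = of_int n \<and> (even n \<longleftrightarrow> even (card (Z m b)))"
    proof (rule IH)
      show "card (Z m b) < card (Z a b)" "finite (Z m b)" by fact+
      show "Z m b \<subseteq> box (Complex m c) (Complex b d)"
      proof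
        fix w assume w: "w \<in> Z m b"
        then have "w \<in> Z a b" "m \<le> Re w" using psub by (auto simp: Z_def in_cbox_complex_iff)
        with inner[of w] show "w \<in> box (Complex m c) (Complex b d)" by (auto simp: in_box_complex_iff)
      qed
    qed (use P m ab psub sub in \<open>auto intro: continuous_on_subset inj_on_subset\<close>)
    then obtain n2 :: int where n2: "box_wind F m b c d = of_int n2" "even n2 \<longleftrightarrow> even (card (Z m b))" by blast
    have "box_wind F a b c d = box_wind F a m c d + box_wind F m b c d"
    proof (rule box_wind_split_Re)
      fix w assume w: "w \<in> box_sides a m c d \<union> box_sides m b c d"
      then have "w \<in> cbox (Complex a c) (Complex b d)" "Re w \<in> {a,m,b} \<or> Im w \<in> {c,d}"
        using m ab P(1) by (auto simp: box_sides_iff in_cbox_complex_iff)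
      then show "F w \<noteq> 0"
        using inner[of w] by (auto simp: Z_def)
    qed (use P m ab in auto)
    then have "box_wind F a b c d = of_int (n1 + n2)" by (simp add: n1 n2)
    moreover have "even (n1 + n2) \<longleftrightarrow> even (card (Z a b))"
      by (simp add: n1 n2 un card_Un_disjoint fin disj)
    ultimately show ?thesis by blast
  qed
  then show ?case unfolding Z_def .
qed

text \<open>The zeros of \<open>g s - h t\<close> on the unit square are the members of
  \<open>Z\<close>. The hypothesis on \<open>fst\<close> provides the distinct real parts that
  \<open>box_wind_parity\<close> asks for, and transversality provides the injective
  derivatives.\<close>

lemma crossing_parity:
  fixes g h :: "real \<Rightarrow> complex"
  defines "Z \<equiv> {(s, t). s \<in> {0..1} \<and> t \<in> {0..1} \<and> g s = h t}"
  assumes cont: "continuous_on {0..1} g" "continuous_on {0..1} h"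
    and fin: "finite Z" and int: "Z \<subseteq> {0<..<1} \<times> {0<..<1}" and inj: "inj_on fst Z"
    and transversal: "\<And>s t. (s, t) \<in> Z \<Longrightarrow> \<exists>a b. (g has_vector_derivative a) (at s) \<and>
      (h has_vector_derivative b) (at t) \<and> (\<forall>x y. x *\<^sub>R a + y *\<^sub>R b = 0 \<longrightarrow> x = 0 \<and> y = 0)"
  shows "\<exists>n::int. winding_number g (h 0) + winding_number h (g 1) -
      winding_number g (h 1) - winding_number h (g 0) = of_int n \<and> (even n \<longleftrightarrow> even (card Z))"
proof -
  define F where "F = (\<lambda>w. g (Re w) - h (Im w))"
  let ?Q = "cbox (Complex 0 0) (Complex 1 1)"
  have contF: "continuous_on ?Q F"
    unfolding F_def
    by (intro continuous_on_diff continuous_on_compose2[OF cont(1)] continuous_on_compose2[OF cont(2)] continuous_intros)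
       (auto simp: in_cbox_complex_iff)
  have zeros: "{z \<in> ?Q. F z = 0} = (\<lambda>(s, t). Complex s t) ` Z"
  proof (intro equalityI subsetI)
    fix z assume "z \<in> {z \<in> ?Q. F z = 0}"
    then have "(Re z, Im z) \<in> Z" by (auto simp: Z_def F_def in_cbox_complex_iff)
    then show "z \<in> (\<lambda>(s, t). Complex s t) ` Z" by (force simp: image_iff)
  qed (auto simp: Z_def F_def in_cbox_complex_iff)
  have card_zeros: "card {z \<in> ?Q. F z = 0} = card Z"
    unfolding zeros by (rule card_image) (auto simp: inj_on_def)
  have "\<exists>n::int. box_wind F 0 1 0 1 = of_int n \<and> (even n \<longleftrightarrow> even (card {z \<in> ?Q. F z = 0}))"
  proof (rule box_wind_parity)
    show "inj_on Re {z \<in> ?Q. F z = 0}"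
    proof -
      have "s = s' \<Longrightarrow> t = t'" if "(s, t) \<in> Z" "(s', t') \<in> Z" for s s' t t'
        using inj_onD[OF inj _ that] by simp
      then show ?thesis unfolding zeros by (auto simp: inj_on_def)
    qed
    show "finite {z \<in> ?Q. F z = 0}"
      "{z \<in> ?Q. F z = 0} \<subseteq> box (Complex 0 0) (Complex 1 1)"
      unfolding zeros using fin int by (auto simp: in_box_complex_iff)
    fix z assume "z \<in> ?Q" "F z = 0"
    then have "(Re z, Im z) \<in> Z" by (auto simp: Z_def F_def in_cbox_complex_iff)
    then obtain a b where ab: "(g has_vector_derivative a) (at (Re z))" "(h has_vector_derivative b) (at (Im z))"
      and ind: "\<And>x y. x *\<^sub>R a + y *\<^sub>R b = 0 \<Longrightarrow> x = 0 \<and> y = 0"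
      using transversal by blast
    \<comment> \<open>A displacement \<open>w\<close> moves the parameter of \<open>g\<close> by
      \<open>Re w\<close> and that of \<open>h\<close> by \<open>Im w\<close>, so independence of
      the two velocities is injectivity of this map.\<close>
    let ?L = "\<lambda>w. Re w *\<^sub>R a - Im w *\<^sub>R b"
    have "(F has_derivative ?L) (at z)"
      unfolding F_def
      by (intro has_derivative_diff has_derivative_compose[OF has_derivative_Re[OF has_derivative_ident]]
          has_derivative_compose[OF has_derivative_Im[OF has_derivative_ident]])
         (use ab in \<open>auto simp: has_vector_derivative_def\<close>)
    moreover have "inj ?L"
    proof (rule injI)
      fix v w assume "?L v = ?L w"
      then have "(Re v - Re w) *\<^sub>R a + (Im w - Im v) *\<^sub>R b = 0"
        by (simp add: algebra_simps)
      from ind[OF this] show "v = w" by (simp add: complex_eq_iff)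
    qed
    ultimately show "\<exists>L. (F has_derivative L) (at z) \<and> inj L" by blast
  qed (use contF in auto)
  then obtain n :: int where n: "box_wind F 0 1 0 1 = of_int n" "even n \<longleftrightarrow> even (card Z)"
    unfolding card_zeros by blast
  have nz: "F z \<noteq> 0" if "z \<in> ?Q" "Re z \<in> {0,1} \<or> Im z \<in> {0,1}" for z
  proof
    assume "F z = 0"
    then have "(Re z, Im z) \<in> Z" using that by (auto simp: Z_def F_def in_cbox_complex_iff)
    then show False using int that(2) by auto
  qed
  have seg: "continuous_on (closed_segment u v) F" "\<And>z. z \<in> closed_segment u v \<Longrightarrow> F z \<noteq> 0"
    if "closed_segment u v \<subseteq> box_sides 0 1 0 1" for u v
    using continuous_on_subset[OF contF order.trans[OF that box_sides_subset]] nz that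
    by (auto simp: box_sides_iff)
  note sides = box_sides_segments[where a = 0 and b = 1 and c = 0 and d = 1]
  have lin: "linepath (Complex a c) (Complex b d) t = Complex (a + t * (b - a)) (c + t * (d - c))" for a b c d t
    by (simp add: linepath_def complex_eq_iff algebra_simps)
  \<comment> \<open>On a horizontal side \<open>h\<close> rests at one of its end points, so
    \<open>F\<close> follows \<open>g\<close> as seen from that point. The top side is traversed
    backwards.\<close>
  have "seg_wind F (Complex 0 0) (Complex 1 0) = winding_number g (h 0)"
    unfolding seg_wind_def winding_number_offset[of g] by (simp add: F_def o_def lin)
  moreover have "seg_wind F (Complex 1 1) (Complex 0 1) = - winding_number g (h 1)"
  proof -
    have "seg_wind F (Complex 1 1) (Complex 0 1) = - seg_wind F (Complex 0 1) (Complex 1 1)"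
      using seg[OF sides(3)] by (intro seg_wind_reverse) (simp_all add: closed_segment_commute)
    then show ?thesis
      unfolding seg_wind_def winding_number_offset[of g] by (simp add: F_def o_def lin)
  qed
  \<comment> \<open>On a vertical side \<open>g\<close> rests and \<open>F\<close> is an end point
    of \<open>g\<close> minus \<open>h\<close>; the change of sign turns this into \<open>h\<close>
    as seen from that end point.\<close>
  moreover have "seg_wind F (Complex 1 0) (Complex 1 1) = winding_number h (g 1)"
  proof -
    have "seg_wind F (Complex 1 0) (Complex 1 1) = seg_wind (\<lambda>w. - F w) (Complex 1 0) (Complex 1 1)"
      by (rule seg_wind_uminus[symmetric]) (use seg[OF sides(2)] in auto)
    then show ?thesis
      unfolding seg_wind_def winding_number_offset[of h] by (simp add: F_def o_def lin)
  qed
  moreover have "seg_wind F (Complex 0 1) (Complex 0 0) = - winding_number h (g 0)"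
  proof -
    have "seg_wind F (Complex 0 1) (Complex 0 0) = - seg_wind F (Complex 0 0) (Complex 0 1)"
      using seg[OF sides(4)] by (intro seg_wind_reverse) (simp_all add: closed_segment_commute)
    also have "seg_wind F (Complex 0 0) (Complex 0 1) = seg_wind (\<lambda>w. - F w) (Complex 0 0) (Complex 0 1)"
      by (rule seg_wind_uminus[symmetric]) (use seg[OF sides(4)] in \<open>auto simp: closed_segment_commute\<close>)
    finally show ?thesis
      unfolding seg_wind_def winding_number_offset[of h] by (simp add: F_def o_def lin)
  qed
  ultimately show ?thesis
    using n by (intro exI[of _ n]) (simp add: box_wind_def)
qed

section \<open>Parity of the crossings of disjoint edges\<close>

lemma UNIV_3_eq: "(UNIV :: 3 set) = {0, 1, 2}"
  unfolding UNIV_3 by auto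

lemma distinct_3: "(0::3) \<noteq> 1" "(0::3) \<noteq> 2" "(1::3) \<noteq> 2" "(1::3) \<noteq> 0" "(2::3) \<noteq> 0" "(2::3) \<noteq> 1"
  by simp_all

lemma three_cases: "x = 0 \<or> x = 1 \<or> x = 2" for x :: 3
  using UNIV_I[of x] unfolding UNIV_3_eq by simp

definition index :: "3 \<Rightarrow> nat" where
  "index a = (if a = 0 then 0 else if a = 1 then 1 else 2)"

text \<open>A reference order on the vertices, left ones before right ones. It decides which of
  \<open>P x - P y\<close> and \<open>P y - P x\<close> receives the principal logarithm.\<close>

fun vertex_rank :: "3 + 3 \<Rightarrow> nat" where
  "vertex_rank (Inl a) = index a"
| "vertex_rank (Inr b) = 3 + index b"

lemma index_inject: "index a = index b \<longleftrightarrow> a = b"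
  using three_cases[of a] three_cases[of b] by (auto simp: index_def)

lemma index_less_3: "index a < 3"
  by (simp add: index_def)

text \<open>Together with \<open>ne_pairs\<close> this lists every unordered pair of disjoint edges
  \<open>a b\<close>, \<open>a' b'\<close> exactly once: the edge with the smaller left end comes
  first, which gives 3 times 6 pairs.\<close>

definition lt_pairs :: "(3 \<times> 3) set" where
  "lt_pairs = {(0, 1), (0, 2), (1, 2)}"

definition ne_pairs :: "(3 \<times> 3) set" where
  "ne_pairs = {(0, 1), (1, 0), (0, 2), (2, 0), (1, 2), (2, 1)}"

lemma lt_pairs_iff: "(a, a') \<in> lt_pairs \<longleftrightarrow> index a < index a'"
  using three_cases[of a] three_cases[of a'] by (auto simp: lt_pairs_def index_def)

lemma ne_pairs_iff: "(b, b') \<in> ne_pairs \<longleftrightarrow> b \<noteq> b'"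
  using three_cases[of b] three_cases[of b'] distinct_3
  by (elim disjE; hypsubst) (simp_all only: ne_pairs_def insert_iff prod.inject empty_iff simp_thms)

lemma sum_3: "sum f (UNIV :: 3 set) = f 0 + (f 1 + (f 2 :: 'a::comm_monoid_add))"
  unfolding UNIV_3_eq
  by (subst sum.insert; (simp only: distinct_3 finite.intros insert_iff empty_iff simp_thms sum.empty add_0_right)?)+

lemma sum_lt_pairs: "(\<Sum>(a, a')\<in>lt_pairs. f a a') = f 0 1 + (f 0 2 + (f 1 2 :: 'a::comm_monoid_add))"
  unfolding lt_pairs_def
  by (subst sum.insert; (simp only: distinct_3 finite.intros insert_iff empty_iff simp_thms prod.inject sum.empty add_0_right prod.case)?)+

lemma sum_ne_pairs:
  "(\<Sum>(b, b')\<in>ne_pairs. f b b') = f 0 1 + (f 1 0 + (f 0 2 + (f 2 0 + (f 1 2 + (f 2 1 :: 'a::comm_monoid_add)))))"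
  unfolding ne_pairs_def
  by (subst sum.insert; (simp only: distinct_3 finite.intros insert_iff empty_iff simp_thms prod.inject sum.empty add_0_right prod.case)?)+

text \<open>\<open>N v a b\<close> plays the integer correction of the angle under which
  \<open>v\<close> sees the edge \<open>a b\<close>. For fixed \<open>a\<close>, \<open>a'\<close>
  each correction at a left vertex occurs for two values of the remaining index, which gives
  \<open>2 * (A a a' - A a' a)\<close>; those at right vertices combine to
  \<open>B a' - B a\<close>.\<close>

lemma K33_index_sum_odd:
  fixes N :: "3 + 3 \<Rightarrow> 3 \<Rightarrow> 3 \<Rightarrow> int"
  shows "odd (\<Sum>(a, a')\<in>lt_pairs. \<Sum>(b, b')\<in>ne_pairs.
    N (Inl a') a b + N (Inr b) a' b' - N (Inr b') a b - N (Inl a) a' b' + (if index b < index b' then 1 else 0))"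
proof -
  define A where "A a a' = (\<Sum>b\<in>UNIV. N (Inl a') a b)" for a a'
  define B where "B a = (\<Sum>(b, b')\<in>ne_pairs. N (Inr b') a b)" for a
  have index: "index 0 = 0" "index 1 = 1" "index 2 = 2"
    by (simp_all add: index_def)
  have sum_ne: "(\<Sum>(b, b')\<in>ne_pairs. x b + y b' b - z b' b - w b') =
      2 * (sum x UNIV - sum w UNIV) + (\<Sum>(b, b')\<in>ne_pairs. y b b') - (\<Sum>(b, b')\<in>ne_pairs. z b' b)"
    for x w :: "3 \<Rightarrow> int" and y z
    unfolding sum_ne_pairs sum_3 by algebra
  have count: "(\<Sum>(b, b')\<in>ne_pairs. if index b < index b' then 1 else 0) = (3 :: int)"
    unfolding sum_ne_pairs index by simp
  have inner: "(\<Sum>(b, b')\<in>ne_pairs.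
      N (Inl a') a b + N (Inr b) a' b' - N (Inr b') a b - N (Inl a) a' b' + (if index b < index b' then 1 else 0)) =
    2 * (A a a' - A a' a) + B a' - B a + 3" (is "?l = _") for a a'
  proof -
    have "?l = (\<Sum>(b, b')\<in>ne_pairs. N (Inl a') a b + N (Inr b) a' b' - N (Inr b') a b - N (Inl a) a' b') +
      (\<Sum>(b, b')\<in>ne_pairs. if index b < index b' then 1 else 0)"
      unfolding sum.distrib[symmetric] by (simp only: case_prod_unfold)
    also have "(\<Sum>(b, b')\<in>ne_pairs. N (Inr b) a' b') = B a'"
      unfolding B_def sum_ne_pairs by algebra
    then have "(\<Sum>(b, b')\<in>ne_pairs. N (Inl a') a b + N (Inr b) a' b' - N (Inr b') a b - N (Inl a) a' b') =
      2 * (A a a' - A a' a) + B a' - B a"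
      unfolding sum_ne by (simp only: A_def B_def)
    finally show ?thesis unfolding count .
  qed
  show ?thesis
  proof -
    \<comment> \<open>The differences of \<open>B\<close> over the three pairs add up to
      \<open>2 * (B 2 - B 0)\<close>, and the constants to 9 = 2 * 4 + 1.\<close>
    have "(\<Sum>(a, a')\<in>lt_pairs. 2 * (A a a' - A a' a) + B a' - B a + 3) =
      2 * (A 0 1 - A 1 0 + A 0 2 - A 2 0 + A 1 2 - A 2 1 + B 2 - B 0 + 4) + 1"
      unfolding sum_lt_pairs by algebra
    then show ?thesis
      unfolding inner by (simp only: even_plus_one_iff dvd_triv_left simp_thms)
  qed
qed

text \<open>The combinatorial core, separated from the immersion: \<open>P\<close> places the
  vertices, \<open>g\<close> draws the edges, and \<open>c\<close> is any family of numbers with the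
  parity of the four-angle sum.\<close>

lemma K33_odd_crossings:
  fixes P :: "3 + 3 \<Rightarrow> complex" and g :: "3 \<Rightarrow> 3 \<Rightarrow> real \<Rightarrow> complex" and c :: "3 \<Rightarrow> 3 \<Rightarrow> 3 \<Rightarrow> 3 \<Rightarrow> nat"
  assumes "inj P"
    and path: "\<And>a b. path (g a b)" and ends: "\<And>a b. g a b 0 = P (Inl a)" "\<And>a b. g a b 1 = P (Inr b)"
    and avoid: "\<And>a b v. v \<noteq> Inl a \<Longrightarrow> v \<noteq> Inr b \<Longrightarrow> P v \<notin> path_image (g a b)"
    and parity: "\<And>a b a' b'. a \<noteq> a' \<Longrightarrow> b \<noteq> b' \<Longrightarrow>
      \<exists>n::int. winding_number (g a b) (P (Inl a')) + winding_number (g a' b') (P (Inr b)) -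
        winding_number (g a b) (P (Inr b')) - winding_number (g a' b') (P (Inl a)) = of_int n \<and>
        (even n \<longleftrightarrow> even (c a b a' b'))"
  shows "odd (\<Sum>(a, a')\<in>lt_pairs. \<Sum>(b, b')\<in>ne_pairs. c a b a' b')"
proof -
  \<comment> \<open>\<open>q\<close> is the principal logarithm in units of full turns.
    \<open>l\<close> uses it in the order of \<open>vertex_rank\<close> and adds half a turn in the
    opposite order; in both orders it exponentiates to \<open>P x - P y\<close>.\<close>
  define q where "q x y = Ln (P x - P y) / (2 * of_real pi * \<i>)" for x y
  define l where "l x y = (if vertex_rank x < vertex_rank y then q x y else q y x + 1 / 2)" for x y
  have exp_q: "exp (2 * of_real pi * \<i> * q x y) = P x - P y" if "x \<noteq> y" for x y
    using that \<open>inj P\<close> by (auto simp: q_def inj_eq)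
  have exp_l: "exp (2 * of_real pi * \<i> * l x y) = P x - P y" if "x \<noteq> y" for x y
  proof (cases "vertex_rank x < vertex_rank y")
    case False
    then have "exp (2 * of_real pi * \<i> * l x y) = exp (2 * of_real pi * \<i> * q y x + of_real pi * \<i>)"
      by (simp add: l_def ring_distribs)
    then show ?thesis using exp_q[of y x] that by (simp add: exp_add mult.commute)
  qed (use that exp_q l_def in simp)
  have swap: "l y x = l x y + 1 / 2" if "vertex_rank x < vertex_rank y" for x y
    using that by (simp add: l_def)
  have "\<exists>N::int. winding_number (g a b) (P v) = l (Inr b) v - l (Inl a) v + of_int N"
    if "v \<noteq> Inl a" "v \<noteq> Inr b" for a b v
  proof -
    \<comment> \<open>The winding number and the difference of the two values of \<open>l\<close>
      exponentiate to the same quotient, so they differ by an integer.\<close>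
    have "P (Inr b) - P v = exp (2 * of_real pi * \<i> * winding_number (g a b) (P v)) * (P (Inl a) - P v)"
      using winding_number_exp_2pi[OF path avoid[OF that]] ends by (simp add: pathstart_def pathfinish_def)
    then have "exp (2 * of_real pi * \<i> * l (Inr b) v) =
        exp (2 * of_real pi * \<i> * winding_number (g a b) (P v) + 2 * of_real pi * \<i> * l (Inl a) v)"
      using that by (simp add: exp_l exp_add)
    then obtain n :: int where "2 * of_real pi * \<i> * l (Inr b) v =
        2 * of_real pi * \<i> * winding_number (g a b) (P v) + 2 * of_real pi * \<i> * l (Inl a) v + of_int (2 * n) * pi * \<i>"
      unfolding exp_eq by auto
    then have "(2 * of_real pi * \<i>) * l (Inr b) v =
        (2 * of_real pi * \<i>) * (winding_number (g a b) (P v) + l (Inl a) v + of_int n)"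
      by (simp add: algebra_simps)
    then have "l (Inr b) v = winding_number (g a b) (P v) + l (Inl a) v + of_int n"
      by (subst (asm) mult_left_cancel) auto
    then show ?thesis by (intro exI[of _ "-n"]) simp
  qed
  then obtain N :: "3 + 3 \<Rightarrow> 3 \<Rightarrow> 3 \<Rightarrow> int" where
    N: "\<And>a b v. v \<noteq> Inl a \<Longrightarrow> v \<noteq> Inr b \<Longrightarrow>
      winding_number (g a b) (P v) = l (Inr b) v - l (Inl a) v + of_int (N v a b)"
    by metis
  \<comment> \<open>The value of the four-angle sum. Reversing the arguments of \<open>l\<close>
    leaves four half turns with signs, whose total is 1 if \<open>b\<close> precedes
    \<open>b'\<close> and 0 otherwise.\<close>
  define m where "m a b a' b' = N (Inl a') a b + N (Inr b) a' b' - N (Inr b') a b - N (Inl a) a' b' +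
    (if index b < index b' then 1 else 0)" for a b a' b'
  have even_diff: "even (int (c a b a' b') - m a b a' b')" if lt: "index a < index a'" and ne: "b \<noteq> b'" for a b a' b'
  proof -
    have "a \<noteq> a'" using lt by auto
    obtain n :: int where n: "winding_number (g a b) (P (Inl a')) + winding_number (g a' b') (P (Inr b)) -
        winding_number (g a b) (P (Inr b')) - winding_number (g a' b') (P (Inl a)) = of_int n"
        "even n \<longleftrightarrow> even (c a b a' b')"
      using parity[OF \<open>a \<noteq> a'\<close> ne] by blast
    have "l (Inr b) (Inl a') = l (Inl a') (Inr b) + 1 / 2" "l (Inr b') (Inl a) = l (Inl a) (Inr b') + 1 / 2"
      using index_less_3[of a] index_less_3[of a'] by (auto intro!: swap)
    moreover have "l (Inl a') (Inl a) = l (Inl a) (Inl a') + 1 / 2"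
      using lt by (auto intro!: swap)
    moreover have "l (Inr b') (Inr b) - l (Inr b) (Inr b') = (if index b < index b' then 1 / 2 else - 1 / 2)"
    proof (cases "index b < index b'")
      case False
      then have "index b' < index b" using index_inject[of b b'] ne by linarith
      then show ?thesis using swap[of "Inr b'" "Inr b"] by simp
    qed (use swap[of "Inr b" "Inr b'"] in simp)
    ultimately have "(of_int n :: complex) = of_int (m a b a' b')"
      using n(1) lt ne \<open>a \<noteq> a'\<close> by (auto simp: N m_def algebra_simps split: if_splits)
    then have "n = m a b a' b'" by (simp only: of_int_eq_iff)
    with n(2) show ?thesis by simp
  qed
  have "even (\<Sum>(a, a')\<in>lt_pairs. \<Sum>(b, b')\<in>ne_pairs. int (c a b a' b') - m a b a' b')"
    by (intro dvd_sum) (auto intro!: dvd_sum even_diff simp: lt_pairs_iff ne_pairs_iff)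
  then have "even (int (\<Sum>(a, a')\<in>lt_pairs. \<Sum>(b, b')\<in>ne_pairs. c a b a' b') -
      (\<Sum>(a, a')\<in>lt_pairs. \<Sum>(b, b')\<in>ne_pairs. m a b a' b'))"
    by (simp add: sum_subtractf case_prod_unfold)
  moreover have "odd (\<Sum>(a, a')\<in>lt_pairs. \<Sum>(b, b')\<in>ne_pairs. m a b a' b')"
    unfolding m_def by (rule K33_index_sum_odd)
  ultimately have "odd (int (\<Sum>(a, a')\<in>lt_pairs. \<Sum>(b, b')\<in>ne_pairs. c a b a' b'))"
    by presburger
  then show ?thesis by (simp only: even_of_nat_iff not_False_eq_True)
qed

section \<open>Circles in graphs\<close>

lemma connected_circle_minus_point:
  fixes S :: "'a::euclidean_space set"
  assumes "S homeomorphic sphere (0 :: real ^ 2) 1"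
  shows "connected (S - {m})"
proof (cases "m \<in> S")
  case True
  obtain f g where fg: "homeomorphism S (sphere (0 :: real ^ 2) 1) f g"
    using assms unfolding homeomorphic_def by blast
  have "inj_on f S" "f ` S = sphere 0 1"
    using inj_on_inverseI[of S g f] homeomorphism_apply1[OF fg] homeomorphism_image1[OF fg] by auto
  then have "f ` (S - {m}) = sphere 0 1 - {f m}"
    using True by (subst inj_on_image_set_diff[of f S]) auto
  then have "homeomorphism (S - {m}) (sphere 0 1 - {f m}) f g"
    by (intro homeomorphism_of_subsets[OF fg]) auto
  then have "(S - {m}) homeomorphic (sphere 0 1 - {f m} :: (real ^ 2) set)"
    unfolding homeomorphic_def by blast
  also have "(sphere 0 1 - {f m}) homeomorphic (UNIV :: real set)"
    using \<open>f ` S = _\<close> True by (intro homeomorphic_punctured_sphere_affine) auto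
  finally show ?thesis
    by (simp add: homeomorphic_connectedness)
next
  case False
  have "connected (sphere (0 :: real ^ 2) 1)"
    by (rule connected_sphere) simp
  then show ?thesis
    using False assms by (simp add: homeomorphic_connectedness)
qed

text \<open>If \<open>S\<close> missed a point of \<open>T\<close>, it would embed into a punctured
  circle and hence into the line. Its image \<open>I\<close> would contain some
  \<open>x < y\<close>, and removing their midpoint would disconnect it, contrary to the previous
  lemma.\<close>

lemma circle_subset_circle_eq:
  fixes S T :: "'a::euclidean_space set"
  assumes S: "S homeomorphic sphere (0 :: real ^ 2) 1" and T: "T homeomorphic sphere (0 :: real ^ 2) 1"
    and "S \<subseteq> T"
  shows "S = T"
proof (rule ccontr)
  assume "S \<noteq> T"
  then obtain p where p: "p \<in> T" "p \<notin> S" using \<open>S \<subseteq> T\<close> by blast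
  obtain f g where fg: "homeomorphism T (sphere (0 :: real ^ 2) 1) f g"
    using T unfolding homeomorphic_def by blast
  have "inj_on f T" "f ` T = sphere 0 1"
    using inj_on_inverseI[of T g f] homeomorphism_apply1[OF fg] homeomorphism_image1[OF fg] by auto
  then have "f p \<in> sphere 0 1" using p(1) by blast
  then have "(sphere 0 1 - {f p}) homeomorphic (UNIV :: real set)"
    by (intro homeomorphic_punctured_sphere_affine) auto
  then obtain h k where hk: "homeomorphism (sphere 0 1 - {f p}) (UNIV :: real set) h k"
    unfolding homeomorphic_def by blast
  have "homeomorphism S (f ` S) f g"
    by (rule homeomorphism_of_subsets[OF fg]) (use \<open>S \<subseteq> T\<close> in auto)
  moreover have "f ` S \<subseteq> sphere 0 1 - {f p}"
    using \<open>f ` T = _\<close> inj_onD[OF \<open>inj_on f T\<close>] p \<open>S \<subseteq> T\<close> by blast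
  then have "homeomorphism (f ` S) (h ` f ` S) h k"
    by (intro homeomorphism_of_subsets[OF hk]) auto
  ultimately have hom: "S homeomorphic (h ` f ` S)"
    using homeomorphism_compose homeomorphic_def by blast
  define I where "I = h ` f ` S"
  have I: "I homeomorphic sphere (0 :: real ^ 2) 1"
    using S hom homeomorphic_sym homeomorphic_trans unfolding I_def by blast
  have "infinite (sphere (0 :: real ^ 2) 1)"
  proof
    assume "finite (sphere (0 :: real ^ 2) 1)"
    moreover have "connected (sphere (0 :: real ^ 2) 1)"
      by (rule connected_sphere) simp
    moreover have "axis 1 1 \<in> sphere (0 :: real ^ 2) 1" "- axis 1 1 \<in> sphere (0 :: real ^ 2) 1"
      by simp_all
    moreover have "axis 1 1 \<noteq> (- axis 1 1 :: real ^ 2)"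
      by (auto simp: vec_eq_iff axis_def dest: spec[of _ 1])
    ultimately show False
      using connected_finite_iff_sing[of "sphere (0 :: real ^ 2) 1"] by (metis empty_iff singletonD)
  qed
  then have "infinite I"
    using I unfolding homeomorphic_def homeomorphism_def by (metis finite_imageI)
  then obtain x' where "x' \<in> I" by fastforce
  moreover have "I - {x'} \<noteq> {}"
    using infinite_remove[OF \<open>infinite I\<close>, of x'] by (metis finite.emptyI)
  then obtain y' where "y' \<in> I" "y' \<noteq> x'" by blast
  ultimately obtain x y where xy: "x \<in> I" "y \<in> I" "x < y"
    by (metis linorder_neqE_linordered_idom)
  define m where "m = (x + y) / 2"
  have "connected (I - {m})" by (rule connected_circle_minus_point[OF I])
  moreover have "x \<in> I - {m}" "y \<in> I - {m}" using xy by (auto simp: m_def)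
  ultimately have "{x..y} \<subseteq> I - {m}"
    by (rule connected_contains_Icc)
  moreover have "m \<in> {x..y}" using xy by (simp add: m_def)
  ultimately show False by blast
qed

section \<open>Coordinates on the realization of a graph\<close>

abbreviation vertex_pt :: "'v::finite \<Rightarrow> real ^ 'v" where
  "vertex_pt v \<equiv> axis v 1"

lemma vertex_pt_nth: "(vertex_pt v :: real ^ 'v::finite) $ w = (if w = v then 1 else 0)"
  by (simp add: axis_def)

lemma vertex_pt_eq_iff [simp]: "vertex_pt u = vertex_pt v \<longleftrightarrow> u = v"
  by (simp add: axis_eq_axis)

lemma edge_path_nth:
  "u \<noteq> v \<Longrightarrow> edge_path u v t $ w = (if w = u then 1 - t else if w = v then t else 0)"
  by (simp add: edge_path_def linepath_def vertex_pt_nth)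

lemma edge_path_0 [simp]: "edge_path u v 0 = vertex_pt u" and edge_path_1 [simp]: "edge_path u v 1 = vertex_pt v"
  by (simp_all add: edge_path_def linepath_def)

lemma hull_edge: "convex hull (vertex_pt ` {u, v}) = edge_path u v ` {0..1}"
  unfolding edge_path_def by (simp add: linepath_image_01 segment_convex_hull)

lemma realization_E:
  assumes "x \<in> realization H" "\<forall>e\<in>edges H. \<exists>u v. u \<noteq> v \<and> e = {u, v}"
  obtains v where "v \<in> verts H" "x = vertex_pt v"
    | u v t where "{u, v} \<in> edges H" "u \<noteq> v" "0 \<le> t" "t \<le> 1" "x = edge_path u v t"
proof -
  consider v where "v \<in> verts H" "x = vertex_pt v" | e where "e \<in> edges H" "x \<in> convex hull (vertex_pt ` e)"
    using assms(1) unfolding realization_def by blast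
  then show thesis
  proof cases
    case (2 e)
    obtain u v where uv: "u \<noteq> v" "e = {u, v}" using assms(2) 2(1) by blast
    with 2(2) obtain t where "0 \<le> t" "t \<le> 1" "x = edge_path u v t"
      unfolding uv(2) hull_edge by auto
    with that(2) uv 2(1) show thesis by blast
  qed (use that in blast)
qed

lemma vertex_pt_in_realization: "v \<in> verts H \<Longrightarrow> vertex_pt v \<in> realization H"
  by (auto simp: realization_def)

lemma edge_path_in_realization:
  assumes "{u, v} \<in> edges H" "0 \<le> t" "t \<le> 1"
  shows "edge_path u v t \<in> realization H"
proof -
  have "edge_path u v t \<in> convex hull (vertex_pt ` {u, v})"
    unfolding hull_edge using assms by auto
  then show ?thesis unfolding realization_def using assms(1) by blast
qed

text \<open>The hypothesis \<open>leaf\<close> allows at most one edge at \<open>v\<close>, so an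
  isolated \<open>v\<close> is excluded as well. The second vertex \<open>w\<close> provides a point
  on the far side of the removed midpoint.\<close>

lemma circle_degree:
  fixes H :: "'v::finite graph"
  assumes circle: "realization H homeomorphic sphere (0 :: real ^ 2) 1"
    and simple: "\<forall>e\<in>edges H. \<exists>u v. u \<noteq> v \<and> e = {u, v}"
    and v: "v \<in> verts H" "w \<in> verts H" "w \<noteq> v" "u \<noteq> v"
    and leaf: "\<And>e. e \<in> edges H \<Longrightarrow> v \<in> e \<Longrightarrow> e = {u, v}"
  shows False
proof -
  define m where "m = edge_path u v (1 / 2)"
  let ?R = "realization H - {m}"
  \<comment> \<open>Only points on the edge from \<open>u\<close> to \<open>v\<close> can have a
    coordinate at \<open>v\<close> strictly between 0 and 1, so the value 1/2 is attained at
    \<open>m\<close> alone.\<close>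
  let ?A = "{x :: real ^ 'v. x $ v < 1 / 2}" and ?B = "{x :: real ^ 'v. x $ v > 1 / 2}"
  have cover: "x \<in> ?A \<union> ?B" if "x \<in> ?R" for x
  proof (rule ccontr)
    assume "x \<notin> ?A \<union> ?B"
    then have half: "x $ v = 1 / 2" by auto
    have "x \<in> realization H" using that by blast
    show False
    proof (cases rule: realization_E[OF \<open>x \<in> realization H\<close> simple])
      case 1
      then show False using half by (auto simp: vertex_pt_nth split: if_splits)
    next
      case (2 a b t)
      then have "v \<in> {a, b}" using half by (auto simp: edge_path_nth split: if_splits)
      then have ab: "{a, b} = {u, v}" using leaf[OF 2(1)] by blast
      then have "t = 1 / 2" using half v(4) 2(2,5) by (auto simp: edge_path_nth doubleton_eq_iff split: if_splits)
      then have "x = m"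
        unfolding m_def vec_eq_iff using 2(2,5) v(4) ab by (auto simp: edge_path_nth doubleton_eq_iff)
      then show False using that by blast
    qed
  qed
  have "open ?A" "open ?B"
    by (auto intro!: open_Collect_less continuous_intros)
  moreover have "?A \<inter> ?B \<inter> ?R = {}" by auto
  moreover have "vertex_pt w \<in> ?A \<inter> ?R" "vertex_pt v \<in> ?B \<inter> ?R"
    using vertex_pt_in_realization[OF v(1)] vertex_pt_in_realization[OF v(2)] v(3,4)
    by (auto simp: vertex_pt_nth m_def vec_eq_iff edge_path_nth split: if_splits intro: exI[of _ v])
  ultimately have "\<not> connected ?R"
    using cover unfolding connected_def by (metis (no_types, lifting) IntD1 IntD2 empty_iff subsetI)
  then show False
    using connected_circle_minus_point[OF circle] by blast
qed

section \<open>Polygons as topological circles\<close>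

fun list_edges :: "'v list \<Rightarrow> 'v set set" where
  "list_edges (u # v # vs) = insert {u, v} (list_edges (v # vs))"
| "list_edges _ = {}"

definition hulls :: "'v::finite set set \<Rightarrow> (real ^ 'v) set" where
  "hulls E = (\<Union>e\<in>E. convex hull (vertex_pt ` e))"

lemma hulls_simps [simp]: "hulls {} = {}" "hulls (insert e E) = convex hull (vertex_pt ` e) \<union> hulls E"
  "hulls (E \<union> E') = hulls E \<union> hulls E'"
  by (auto simp: hulls_def)

text \<open>Coordinates serve to bound intersections: where the coordinate of an end point of an
  edge vanishes, only the other end of that edge remains.\<close>

lemma list_edges_nth_0:
  fixes x :: "real ^ 'v::finite"
  assumes "x \<in> hulls (list_edges vs)" "w \<notin> set vs" "distinct vs"
  shows "x $ w = 0"
  using assms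
proof (induction vs rule: list_edges.induct)
  case (1 u v vs)
  show ?case
  proof (cases "x \<in> hulls (list_edges (v # vs))")
    case False
    then obtain t where "x = edge_path u v t" using 1(2) unfolding list_edges.simps hulls_simps hull_edge by auto
    then show ?thesis using 1(3,4) by (auto simp: edge_path_nth)
  qed (use 1 in auto)
qed auto

lemma edge_point_nth_0:
  fixes x :: "real ^ 'v::finite"
  assumes "x \<in> convex hull (vertex_pt ` {u, v})" "x $ u = 0" "u \<noteq> v"
  shows "x = vertex_pt v"
  using assms unfolding hull_edge by (auto simp: edge_path_nth vec_eq_iff vertex_pt_nth)

text \<open>The first edge is put in front of the arc for the rest. The coordinate at
  \<open>u\<close> vanishes on the rest and on the first edge only at \<open>v\<close>, so the two
  meet in \<open>v\<close> alone.\<close>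

lemma polyline_arc:
  assumes "distinct vs" "length vs \<ge> 2"
  shows "\<exists>g. arc g \<and> pathstart g = vertex_pt (hd vs) \<and> pathfinish g = vertex_pt (last vs) \<and>
    path_image g = hulls (list_edges vs)"
  using assms
proof (induction vs rule: list_edges.induct)
  case (1 u v vs)
  have "u \<noteq> v" using 1 by auto
  have seg: "path_image (linepath (vertex_pt u) (vertex_pt v)) = convex hull (vertex_pt ` {u, v})"
    by (simp add: segment_convex_hull)
  show ?case
  proof (cases vs)
    case Nil
    then show ?thesis
      using seg \<open>u \<noteq> v\<close> by (intro exI[of _ "linepath (vertex_pt u) (vertex_pt v)"]) (auto intro!: arc_linepath)
  next
    case (Cons w ws)
    with 1 obtain g where g: "arc g" "pathstart g = vertex_pt v" "pathfinish g = vertex_pt (last vs)"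
      "path_image g = hulls (list_edges (v # vs))"
      by auto
    have "arc (linepath (vertex_pt u) (vertex_pt v) +++ g)"
    proof (rule arc_join)
      show "path_image (linepath (vertex_pt u) (vertex_pt v)) \<inter> path_image g \<subseteq> {pathstart g}"
      proof
        fix x assume x: "x \<in> path_image (linepath (vertex_pt u) (vertex_pt v)) \<inter> path_image g"
        then have "x $ u = 0"
          using 1(2) g(4) by (intro list_edges_nth_0[of x "v # vs"]) auto
        then have "x = vertex_pt v"
          using x \<open>u \<noteq> v\<close> seg by (intro edge_point_nth_0) auto
        then show "x \<in> {pathstart g}" using g by simp
      qed
    qed (use g \<open>u \<noteq> v\<close> in \<open>auto intro!: arc_linepath\<close>)
    moreover have "path_image (linepath (vertex_pt u) (vertex_pt v) +++ g) = hulls (list_edges (u # v # vs))"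
      using g seg by (subst path_image_join) auto
    ultimately show ?thesis
      using g Cons by (intro exI[of _ "linepath (vertex_pt u) (vertex_pt v) +++ g"]) auto
  qed
qed auto

text \<open>The polygon consists of the arc along \<open>vs\<close> and the arc of two edges through
  the extra vertex \<open>x\<close>. By the coordinate at \<open>x\<close> they meet only in their
  common ends and form a simple loop.\<close>

lemma polygon_circle:
  assumes "distinct (x # vs)" "length vs \<ge> 2"
  shows "hulls (list_edges vs \<union> list_edges [last vs, x, hd vs]) homeomorphic sphere (0 :: real ^ 2) 1"
proof -
  have ne: "vs \<noteq> []" "hd vs \<noteq> last vs" "hd vs \<noteq> x" "last vs \<noteq> x"
    using assms by (cases vs; auto split: if_splits)+
  obtain g where g: "arc g" "pathstart g = vertex_pt (hd vs)" "pathfinish g = vertex_pt (last vs)"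
    "path_image g = hulls (list_edges vs)"
    using polyline_arc[of vs] assms by auto
  obtain h where h: "arc h" "pathstart h = vertex_pt (last vs)" "pathfinish h = vertex_pt (hd vs)"
    "path_image h = hulls (list_edges [last vs, x, hd vs])"
    using polyline_arc[of "[last vs, x, hd vs]"] ne by auto
  have "simple_path (g +++ h)"
  proof (rule simple_path_join_loop)
    show "path_image g \<inter> path_image h \<subseteq> {pathstart g, pathstart h}"
    proof
      fix p assume p: "p \<in> path_image g \<inter> path_image h"
      then have "p $ x = 0"
        using assms g(4) by (intro list_edges_nth_0[of p vs]) auto
      moreover have "p \<in> convex hull (vertex_pt ` {x, last vs}) \<or> p \<in> convex hull (vertex_pt ` {x, hd vs})"
        using p h(4) by (auto simp: insert_commute)
      ultimately show "p \<in> {pathstart g, pathstart h}"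
        using ne edge_point_nth_0[of p x "last vs"] edge_point_nth_0[of p x "hd vs"]
        unfolding g(2) h(2) by (metis insertCI)
    qed
  qed (use g h in auto)
  then have "path_image (g +++ h) homeomorphic sphere (0 :: complex) 1"
    by (rule homeomorphic_simple_path_image_circle) (use g h in auto)
  also have "sphere (0 :: complex) 1 homeomorphic sphere (0 :: real ^ 2) 1"
    by (rule homeomorphic_spheres_gen) auto
  finally show ?thesis
    using g h by (simp only: path_image_join hulls_simps(3))
qed

section \<open>The cycles of the complete bipartite graph\<close>

definition edge_pairs :: "(3 + 3) graph \<Rightarrow> (3 \<times> 3) set" where
  "edge_pairs H = {(a, b). {Inl a, Inr b} \<in> edges H}"

text \<open>The subgraph spanned by a set of edges; by the choice of \<open>verts\<close> it has no
  isolated vertices.\<close>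

definition bip_graph :: "(3 \<times> 3) set \<Rightarrow> (3 + 3) graph" where
  "bip_graph C = (let E = (\<lambda>(a, b). {Inl a, Inr b}) ` C in \<lparr>verts = \<Union>E, edges = E\<rparr>)"

lemma Inl_Inr_doubleton_eq_iff [simp]: "{Inl a, Inr b} = {Inl a', Inr b'} \<longleftrightarrow> a = a' \<and> b = b'"
  by (auto simp: doubleton_eq_iff)

lemma edges_K33: "e \<in> edges K33 \<longleftrightarrow> (\<exists>a b. e = {Inl a, Inr b})"
  by (auto simp: K33_def complete_bipartite_def)

lemma edges_K33_E:
  assumes "{u, v} \<in> edges K33"
  obtains a b where "u = Inl a" "v = Inr b" | b a where "u = Inr b" "v = Inl a"
  using assms unfolding edges_K33 by (auto simp: doubleton_eq_iff)

lemma subgraph_edges: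
  assumes "subgraph_of H K33"
  shows "edges H = (\<lambda>(a, b). {Inl a, Inr b}) ` edge_pairs H"
proof (intro equalityI subsetI)
  fix e assume e: "e \<in> edges H"
  then obtain a b where "e = {Inl a, Inr b}"
    using assms unfolding subgraph_of_def by (metis edges_K33 subsetD)
  then show "e \<in> (\<lambda>(a, b). {Inl a, Inr b}) ` edge_pairs H" using e by (auto simp: edge_pairs_def)
qed (auto simp: edge_pairs_def)

lemma card_edges:
  assumes "subgraph_of H K33"
  shows "card (edges H) = card (edge_pairs H)"
  unfolding subgraph_edges[OF assms] by (rule card_image) (auto simp: inj_on_def)

lemma subgraph_simple:
  assumes "subgraph_of H K33"
  shows "\<forall>e\<in>edges H. \<exists>u v. u \<noteq> v \<and> e = {u, v}"
  unfolding subgraph_edges[OF assms] by force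

lemma subgraph_verts:
  assumes "subgraph_of H K33" "(a, b) \<in> edge_pairs H"
  shows "Inl a \<in> verts H" "Inr b \<in> verts H"
  using assms unfolding subgraph_of_def edge_pairs_def by auto

lemma edge_pairs_bip_graph [simp]: "edge_pairs (bip_graph C) = C"
  by (auto simp: edge_pairs_def bip_graph_def Let_def)

lemma subgraph_bip_graph: "subgraph_of (bip_graph C) K33"
  by (auto simp: subgraph_of_def bip_graph_def Let_def edges_K33 K33_def complete_bipartite_def)

lemma subgraph_realization_E:
  assumes "subgraph_of H K33" "x \<in> realization H"
  obtains v where "v \<in> verts H" "x = vertex_pt v"
    | a b t where "(a, b) \<in> edge_pairs H" "0 \<le> t" "t \<le> 1" "x = edge_path (Inl a) (Inr b) t"
proof (cases rule: realization_E[OF assms(2) subgraph_simple[OF assms(1)]])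
  case (2 u v t)
  have "{u, v} \<in> edges K33" using assms(1) 2(1) by (auto simp: subgraph_of_def)
  then show ?thesis
  proof (cases rule: edges_K33_E)
    case (1 a b)
    with 2 that(2) show ?thesis by (auto simp: edge_pairs_def)
  next
    case (2 b a)
    note uv = 2
    have "x = edge_path (Inl a) (Inr b) (1 - t)"
      using \<open>x = edge_path u v t\<close> uv by (simp add: edge_path_def linepath_def)
    moreover have "(a, b) \<in> edge_pairs H"
      using \<open>{u, v} \<in> edges H\<close> uv by (simp add: edge_pairs_def insert_commute)
    ultimately show ?thesis using that(2)[of a b "1 - t"] \<open>0 \<le> t\<close> \<open>t \<le> 1\<close> by simp
  qed
qed (use that in blast)

lemma edge_path_nth_Inl_Inr [simp]:
  "edge_path (Inl a) (Inr b) t $ Inl a' = (if a' = a then 1 - t else 0)"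
  "edge_path (Inl a) (Inr b) t $ Inr b' = (if b' = b then t else 0)"
  by (auto simp: edge_path_nth)

lemma edge_path_neq_vertex_pt:
  assumes "0 < t" "t < 1"
  shows "edge_path (Inl a) (Inr b) t \<noteq> vertex_pt v"
proof
  assume eq: "edge_path (Inl a) (Inr b) t = vertex_pt v"
  have "edge_path (Inl a) (Inr b) t $ Inl a = vertex_pt v $ Inl a" "edge_path (Inl a) (Inr b) t $ Inr b = vertex_pt v $ Inr b"
    using eq by simp_all
  then show False
    using assms by (auto simp: vertex_pt_nth split: if_splits)
qed

lemma edge_path_inject:
  assumes "0 < t" "t < 1" "edge_path (Inl a) (Inr b) t = edge_path (Inl a') (Inr b') t'"
  shows "a = a'" "b = b'" "t = t'"
proof -
  have "edge_path (Inl a) (Inr b) t $ Inl a = edge_path (Inl a') (Inr b') t' $ Inl a"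
    "edge_path (Inl a) (Inr b) t $ Inr b = edge_path (Inl a') (Inr b') t' $ Inr b"
    using assms(3) by simp_all
  then show "a = a'" "b = b'" "t = t'"
    using assms(1,2) by (auto split: if_splits)
qed

lemma edge_path_realization_iff:
  assumes "subgraph_of H K33" "0 < t" "t < 1"
  shows "edge_path (Inl a) (Inr b) t \<in> realization H \<longleftrightarrow> (a, b) \<in> edge_pairs H"
proof
  assume x: "edge_path (Inl a) (Inr b) t \<in> realization H"
  show "(a, b) \<in> edge_pairs H"
  proof (cases rule: subgraph_realization_E[OF assms(1) x])
    case (2 a' b' t')
    then show ?thesis using edge_path_inject[OF assms(2,3)] by metis
  qed (use edge_path_neq_vertex_pt[OF assms(2,3)] in blast)
qed (use assms in \<open>auto simp: edge_pairs_def intro!: edge_path_in_realization\<close>)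

lemma vertex_pt_realization_iff:
  assumes "subgraph_of H K33"
  shows "vertex_pt v \<in> realization H \<longleftrightarrow> v \<in> verts H"
proof
  assume x: "vertex_pt v \<in> realization H"
  show "v \<in> verts H"
  proof (cases rule: subgraph_realization_E[OF assms x])
    case (2 a b t)
    then have "(vertex_pt v :: real ^ (3 + 3)) $ v = edge_path (Inl a) (Inr b) t $ v" by simp
    then have "v = Inl a \<or> v = Inr b"
      by (auto simp: vertex_pt_nth edge_path_nth split: if_splits)
    then show ?thesis using subgraph_verts[OF assms 2(1)] by auto
  qed auto
qed (rule vertex_pt_in_realization)

text \<open>Midpoints of edges and vertex points detect which edges and vertices are
  present.\<close>

lemma realization_inject:
  assumes "subgraph_of H K33" "subgraph_of H' K33" "realization H = realization H'"
  shows "H = H'"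
proof -
  have "edge_pairs H = edge_pairs H'"
    using edge_path_realization_iff[OF assms(1), of "1 / 2"] edge_path_realization_iff[OF assms(2), of "1 / 2"] assms(3)
    by auto
  then have "edges H = edges H'"
    using subgraph_edges assms(1,2) by simp
  moreover have "verts H = verts H'"
    using vertex_pt_realization_iff[OF assms(1)] vertex_pt_realization_iff[OF assms(2)] assms(3) by auto
  ultimately show ?thesis by simp
qed

lemma realization_bip_graph: "realization (bip_graph C) = hulls ((\<lambda>(a, b). {Inl a, Inr b}) ` C)"
proof -
  have "vertex_pt v \<in> hulls ((\<lambda>(a, b). {Inl a, Inr b}) ` C)" if "v \<in> verts (bip_graph C)" for v
  proof -
    have "\<exists>e\<in>(\<lambda>(a, b). {Inl a, Inr b}) ` C. v \<in> e"
      using that by (simp add: bip_graph_def)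
    then obtain e where e: "e \<in> (\<lambda>(a, b). {Inl a, Inr b}) ` C" "v \<in> e" by blast
    have "vertex_pt v \<in> convex hull (vertex_pt ` e)"
      by (rule hull_inc) (rule imageI[OF e(2)])
    with e(1) show ?thesis unfolding hulls_def by blast
  qed
  then show ?thesis unfolding realization_def hulls_def bip_graph_def by (auto simp: Let_def)
qed

lemma realization_bip_graph_mono:
  assumes "subgraph_of H K33" "C \<subseteq> edge_pairs H"
  shows "realization (bip_graph C) \<subseteq> realization H"
  unfolding realization_bip_graph hulls_def using assms(2) by (auto simp: realization_def edge_pairs_def)

section \<open>Squares and hexagons as the only circles\<close>

text \<open>The 4-cycle avoiding the left vertex \<open>a\<close> and the right vertex
  \<open>b\<close>.\<close>

definition square :: "3 \<Rightarrow> 3 \<Rightarrow> (3 \<times> 3) set" where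
  "square a b = (- {a}) \<times> (- {b})"

text \<open>For injective \<open>m\<close> this is the complement of the perfect matching that joins
  each \<open>a\<close> to \<open>m a\<close>, and such a complement is a 6-cycle.\<close>

definition hexagon :: "(3 \<Rightarrow> 3) \<Rightarrow> (3 \<times> 3) set" where
  "hexagon m = {(a, b). b \<noteq> m a}"

lemma third_element:
  fixes a b :: 3
  assumes "a \<noteq> b"
  obtains c where "UNIV = {a, b, c}" "c \<noteq> a" "c \<noteq> b"
proof -
  have "card (- {a, b}) = 1"
    using assms by (subst Compl_eq_Diff_UNIV, subst card_Diff_subset) auto
  then obtain c where "- {a, b} = {c}" by (auto simp: card_1_singleton_iff)
  then have "UNIV = {a, b, c}" "c \<noteq> a" "c \<noteq> b" by auto
  then show thesis by (rule that)
qed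

lemma two_others:
  fixes a :: 3
  obtains b c where "- {a} = {b, c}" "b \<noteq> c" "a \<noteq> b" "a \<noteq> c"
proof -
  have "card (- {a}) = 2" by (subst Compl_eq_Diff_UNIV, subst card_Diff_subset) auto
  then obtain b c where "- {a} = {b, c}" "b \<noteq> c" by (auto simp: card_2_iff)
  moreover from this have "a \<noteq> b" "a \<noteq> c" by auto
  ultimately show thesis by (rule that)
qed

lemma square_circle: "realization (bip_graph (square a b)) homeomorphic sphere (0 :: real ^ 2) 1"
  and card_square: "card (square a b) = 4"
proof -
  obtain a1 a2 where a: "- {a} = {a1, a2}" "a1 \<noteq> a2" by (rule two_others)
  obtain b1 b2 where b: "- {b} = {b1, b2}" "b1 \<noteq> b2" by (rule two_others)
  have sq: "square a b = {(a1, b1), (a1, b2), (a2, b1), (a2, b2)}"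
    unfolding square_def a b by auto
  have "(\<lambda>(a, b). {Inl a, Inr b}) ` square a b =
      list_edges [Inr b1, Inl a2, Inr b2] \<union> list_edges [last [Inr b1, Inl a2, Inr b2], Inl a1, hd [Inr b1, Inl a2, Inr b2]]"
    unfolding sq by (simp add: insert_commute)
  then show "realization (bip_graph (square a b)) homeomorphic sphere (0 :: real ^ 2) 1"
    unfolding realization_bip_graph using a(2) b(2) by (simp only:) (rule polygon_circle, auto)
  show "card (square a b) = 4"
    unfolding sq using a(2) b(2) by simp
qed

lemma hexagon_circle:
  assumes "inj m"
  shows "realization (bip_graph (hexagon m)) homeomorphic sphere (0 :: real ^ 2) 1" and "card (hexagon m) = 6"
proof -
  obtain a b c :: 3 where abc: "UNIV = {a, b, c}" "b \<noteq> c" "a \<noteq> b" "a \<noteq> c"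
  proof -
    obtain b c where "- {0} = {b, c}" "b \<noteq> c" "(0::3) \<noteq> b" "(0::3) \<noteq> c" by (rule two_others)
    moreover from this have "UNIV = {0, b, c}" by auto
    ultimately show thesis using that by blast
  qed
  have "range m = UNIV" using assms by (simp add: finite_UNIV_inj_surj)
  then have m: "UNIV = {m a, m b, m c}" unfolding abc(1) by auto
  have ne: "m a \<noteq> m b" "m a \<noteq> m c" "m b \<noteq> m c" using abc assms by (auto simp: inj_eq)
  have hx: "hexagon m = {(a, m b), (a, m c), (b, m a), (b, m c), (c, m a), (c, m b)}"
  proof -
    have "(x, y) \<in> hexagon m \<longleftrightarrow> (x, y) \<in> {(a, m b), (a, m c), (b, m a), (b, m c), (c, m a), (c, m b)}" for x y
    proof -
      have "x = a \<or> x = b \<or> x = c" "y = m a \<or> y = m b \<or> y = m c"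
        using abc(1) m UNIV_I by blast+
      then show ?thesis
        by (elim disjE) (simp_all add: hexagon_def ne ne[symmetric] abc(2-4) abc(2-4)[symmetric])
    qed
    then show ?thesis unfolding set_eq_iff split_paired_All by (intro allI)
  qed
  \<comment> \<open>The hexagon runs through \<open>a\<close>, \<open>m b\<close>, \<open>c\<close>,
    \<open>m a\<close>, \<open>b\<close>, \<open>m c\<close> and back; no vertex is next to its
    partner under \<open>m\<close>.\<close>
  let ?vs = "[Inr (m b), Inl c, Inr (m a), Inl b, Inr (m c)]"
  have "(\<lambda>(a, b). {Inl a, Inr b}) ` hexagon m = list_edges ?vs \<union> list_edges [last ?vs, Inl a, hd ?vs]"
    unfolding hx by (simp add: insert_commute)
  then show "realization (bip_graph (hexagon m)) homeomorphic sphere (0 :: real ^ 2) 1"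
    unfolding realization_bip_graph using abc(2-4) ne by (simp only:) (rule polygon_circle, auto)
  show "card (hexagon m) = 6"
    unfolding hx using abc(2-4) ne by simp
qed

text \<open>Starting from two edges \<open>a0 b1\<close>, \<open>a0 b2\<close>, continue to
  \<open>a1\<close> at \<open>b1\<close> and \<open>a2\<close> at \<open>b2\<close>. Without a
  square \<open>a1\<close> and \<open>a2\<close> differ, and the second edge at each of them has to
  end in the third vertex \<open>b3\<close>, which closes a hexagon.\<close>

lemma min_degree_two:
  fixes E :: "(3 \<times> 3) set"
  assumes "E \<noteq> {}"
    and right: "\<And>a b. (a, b) \<in> E \<Longrightarrow> \<exists>b'. b' \<noteq> b \<and> (a, b') \<in> E"
    and left: "\<And>a b. (a, b) \<in> E \<Longrightarrow> \<exists>a'. a' \<noteq> a \<and> (a', b) \<in> E"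
  shows "(\<exists>a b. square a b \<subseteq> E) \<or> (\<exists>m. inj m \<and> hexagon m \<subseteq> E)"
  unfolding disj_imp
proof (rule impI)
  assume nosq: "\<not> (\<exists>a b. square a b \<subseteq> E)"
  have no_square: False
    if "(a1, b1) \<in> E" "(a1, b2) \<in> E" "(a2, b1) \<in> E" "(a2, b2) \<in> E" "a1 \<noteq> a2" "b1 \<noteq> b2" for a1 a2 b1 b2
  proof -
    obtain a where a: "UNIV = {a1, a2, a}" "a \<noteq> a1" "a \<noteq> a2" using third_element[OF \<open>a1 \<noteq> a2\<close>] .
    obtain b where b: "UNIV = {b1, b2, b}" "b \<noteq> b1" "b \<noteq> b2" using third_element[OF \<open>b1 \<noteq> b2\<close>] .
    have "square a b \<subseteq> E"
    proof
      fix z assume z: "z \<in> square a b"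
      have "fst z \<in> {a1, a2, a}" "snd z \<in> {b1, b2, b}" unfolding a(1)[symmetric] b(1)[symmetric] by auto
      then show "z \<in> E" using z that by (cases z) (auto simp: square_def)
    qed
    with nosq show False by blast
  qed
  obtain a0 b1 where e01: "(a0, b1) \<in> E" using \<open>E \<noteq> {}\<close> by auto
  obtain b2 where e02: "b2 \<noteq> b1" "(a0, b2) \<in> E" using right[OF e01] by blast
  obtain a1 where e11: "a1 \<noteq> a0" "(a1, b1) \<in> E" using left[OF e01] by blast
  obtain a2 where e22: "a2 \<noteq> a0" "(a2, b2) \<in> E" using left[OF e02(2)] by blast
  have "a1 \<noteq> a2" using no_square[of a0 b1 b2 a1] e01 e02 e11 e22 by auto
  obtain b3 where b3: "UNIV = {b1, b2, b3}" "b3 \<noteq> b1" "b3 \<noteq> b2" using third_element[OF e02(1)[symmetric]] .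
  have b3': "b = b1 \<or> b = b2 \<or> b = b3" for b using b3(1) UNIV_I by blast
  obtain b where "b \<noteq> b1" "(a1, b) \<in> E" using right[OF e11(2)] by blast
  then have e13: "(a1, b3) \<in> E"
    using b3'[of b] no_square[of a0 b1 b2 a1] e01 e02 e11 by auto
  obtain b where "b \<noteq> b2" "(a2, b) \<in> E" using right[OF e22(2)] by blast
  then have e23: "(a2, b3) \<in> E"
    using b3'[of b] no_square[of a0 b1 b2 a2] e01 e02 e22 by auto
  have a: "a = a0 \<or> a = a1 \<or> a = a2" for a
    using third_element[OF \<open>a1 \<noteq> a2\<close>] e11(1) e22(1) by (metis UNIV_I insert_iff singletonD)
  \<comment> \<open>\<open>m\<close> sends each left vertex to the one right vertex that it does not
    meet in this hexagon.\<close>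
  define m where "m a = (if a = a0 then b3 else if a = a1 then b2 else b1)" for a
  have "inj m"
    unfolding inj_def m_def using a b3(2,3) e02(1) by metis
  moreover have "(x, y) \<in> E" if "y \<noteq> m x" for x y
    using that a[of x] b3'[of y] e01 e02 e11 e22 e13 e23 \<open>a1 \<noteq> a2\<close> unfolding m_def by auto
  then have "hexagon m \<subseteq> E" by (auto simp: hexagon_def)
  ultimately show "\<exists>m. inj m \<and> hexagon m \<subseteq> E" by blast
qed

text \<open>Vertices of degree one are ruled out, so \<open>H\<close> contains a square or a
  hexagon. That is already a circle, hence it fills the realization of \<open>H\<close>, and the
  realization determines edges and vertices.\<close>

lemma circle_subgraph:
  assumes H: "subgraph_of H K33" and circle: "realization H homeomorphic sphere (0 :: real ^ 2) 1"
    and "edges H \<noteq> {}"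
  shows "(\<exists>a b. H = bip_graph (square a b)) \<or> (\<exists>m. inj m \<and> H = bip_graph (hexagon m))"
proof -
  have degree: False if "v \<in> verts H" "w \<in> verts H" "w \<noteq> v" "u \<noteq> v" "\<And>e. e \<in> edges H \<Longrightarrow> v \<in> e \<Longrightarrow> e = {u, v}" for u v w
    using circle_degree[OF circle subgraph_simple[OF H] that] .
  have right: "\<exists>b'. b' \<noteq> b \<and> (a, b') \<in> edge_pairs H" if ab: "(a, b) \<in> edge_pairs H" for a b
  proof (rule ccontr)
    assume no: "\<not> (\<exists>b'. b' \<noteq> b \<and> (a, b') \<in> edge_pairs H)"
    have "e = {Inr b, Inl a}" if "e \<in> edges H" "Inl a \<in> e" for e
      using that no unfolding subgraph_edges[OF H] by auto
    then show False
      using degree[of "Inl a" "Inr b" "Inr b"] subgraph_verts[OF H ab] by auto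
  qed
  have left: "\<exists>a'. a' \<noteq> a \<and> (a', b) \<in> edge_pairs H" if ab: "(a, b) \<in> edge_pairs H" for a b
  proof (rule ccontr)
    assume no: "\<not> (\<exists>a'. a' \<noteq> a \<and> (a', b) \<in> edge_pairs H)"
    have "e = {Inl a, Inr b}" if "e \<in> edges H" "Inr b \<in> e" for e
      using that no unfolding subgraph_edges[OF H] by auto
    then show False
      using degree[of "Inr b" "Inl a" "Inl a"] subgraph_verts[OF H ab] by auto
  qed
  have eq: "H = bip_graph C" if "C \<subseteq> edge_pairs H" "realization (bip_graph C) homeomorphic sphere (0 :: real ^ 2) 1" for C
    using circle_subset_circle_eq[OF that(2) circle realization_bip_graph_mono[OF H that(1)]]
      realization_inject[OF subgraph_bip_graph H] by metis
  have "edge_pairs H \<noteq> {}" using \<open>edges H \<noteq> {}\<close> subgraph_edges[OF H] by auto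
  from min_degree_two[OF this right left] show ?thesis
    using eq square_circle hexagon_circle(1) by meson
qed

lemma card_edges_bip_graph: "card (edges (bip_graph C)) = card C"
  using card_edges[OF subgraph_bip_graph] by simp

lemma cycles_4: "cycles 4 K33 = (\<lambda>(a, b). bip_graph (square a b)) ` UNIV"
proof (intro equalityI subsetI)
  fix H assume "H \<in> cycles 4 K33"
  then have H: "subgraph_of H K33" "realization H homeomorphic sphere (0 :: real ^ 2) 1" "card (edges H) = 4"
    by (auto simp: cycles_def)
  then have "edges H \<noteq> {}" by auto
  from circle_subgraph[OF H(1,2) this] show "H \<in> (\<lambda>(a, b). bip_graph (square a b)) ` UNIV"
    using H(3) hexagon_circle(2) card_edges_bip_graph by fastforce
qed (auto simp: cycles_def subgraph_bip_graph card_edges_bip_graph card_square square_circle)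

lemma cycles_6: "cycles 6 K33 = (\<lambda>m. bip_graph (hexagon m)) ` {m. inj m}"
proof (intro equalityI subsetI)
  fix H assume "H \<in> cycles 6 K33"
  then have H: "subgraph_of H K33" "realization H homeomorphic sphere (0 :: real ^ 2) 1" "card (edges H) = 6"
    by (auto simp: cycles_def)
  then have "edges H \<noteq> {}" by auto
  from circle_subgraph[OF H(1,2) this] show "H \<in> (\<lambda>m. bip_graph (hexagon m)) ` {m. inj m}"
    using H(3) card_square card_edges_bip_graph by fastforce
qed (auto simp: cycles_def subgraph_bip_graph card_edges_bip_graph hexagon_circle)

lemma cycles_subgraph: "\<gamma> \<in> cycles k K33 \<Longrightarrow> subgraph_of \<gamma> K33"
  by (simp add: cycles_def)

section \<open>Cycles through two given edges\<close>

text \<open>The count is a product of two factors, one for each side; a factor is 1 if the two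
  indices on that side differ and 2 if they agree.\<close>

lemma count_squares:
  "odd (card {(c, d). {(a, b), (a', b')} \<subseteq> square c d}) \<longleftrightarrow> a \<noteq> a' \<and> b \<noteq> b'"
proof -
  have "{(c, d). {(a, b), (a', b')} \<subseteq> square c d} = (- {a, a'}) \<times> (- {b, b'})"
    by (auto simp: square_def)
  moreover have "card (- {x, y}) = (if x = y then 2 else 1)" for x y :: 3
    by (subst Compl_eq_Diff_UNIV, subst card_Diff_subset) auto
  ultimately show ?thesis by (simp add: card_cartesian_product)
qed

text \<open>Encodes a function on \<open>3\<close> by its values, so that the six permutations
  become an explicit list.\<close>

fun triple_fun :: "'a \<times> 'a \<times> 'a \<Rightarrow> 3 \<Rightarrow> 'a" where
  "triple_fun (x, y, z) a = (if a = 0 then x else if a = 1 then y else z)"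

definition perm_triples :: "(3 \<times> 3 \<times> 3) set" where
  "perm_triples = {(0, 1, 2), (0, 2, 1), (1, 0, 2), (1, 2, 0), (2, 0, 1), (2, 1, 0)}"

lemma triple_fun_simps: "triple_fun (x, y, z) 0 = x" "triple_fun (x, y, z) 1 = y" "triple_fun (x, y, z) 2 = z"
  by (simp_all add: distinct_3)

lemma triple_fun_eta: "triple_fun (m 0, m 1, m 2) = m"
proof
  fix a show "triple_fun (m 0, m 1, m 2) a = m a"
    using three_cases[of a] by (elim disjE; hypsubst) (simp_all only: triple_fun_simps)
qed

lemma inj_triple_fun: "inj triple_fun"
proof (rule injI)
  fix s t :: "'a \<times> 'a \<times> 'a" assume eq: "triple_fun s = triple_fun t"
  obtain x y z x' y' z' where st: "s = (x, y, z)" "t = (x', y', z')" by (metis prod_cases3)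
  show "s = t"
    using fun_cong[OF eq, of 0] fun_cong[OF eq, of 1] fun_cong[OF eq, of 2]
    unfolding st by (simp only: triple_fun_simps)
qed

lemma inj_3: "{m :: 3 \<Rightarrow> 3. inj m} = triple_fun ` perm_triples"
proof (intro equalityI subsetI)
  fix m :: "3 \<Rightarrow> 3" assume "m \<in> {m. inj m}"
  then have ne: "m 0 \<noteq> m 1" "m 0 \<noteq> m 2" "m 1 \<noteq> m 2" by (simp_all add: inj_eq)
  have "(x, y, z) \<in> perm_triples" if "x \<noteq> y" "x \<noteq> z" "y \<noteq> z" for x y z
    using three_cases[of x] three_cases[of y] three_cases[of z] that
    by (elim disjE; hypsubst) (simp_all only: perm_triples_def insert_iff prod.inject simp_thms)
  from this[OF ne] show "m \<in> triple_fun ` perm_triples"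
    by (metis image_eqI triple_fun_eta)
next
  fix m :: "3 \<Rightarrow> 3" assume "m \<in> triple_fun ` perm_triples"
  then obtain x y z where m: "m = triple_fun (x, y, z)" "x \<noteq> y" "x \<noteq> z" "y \<noteq> z"
    unfolding perm_triples_def using distinct_3 by blast
  have "u = v" if "m u = m v" for u v
    using three_cases[of u] three_cases[of v] that m(2-4) m(2-4)[symmetric] unfolding m(1)
    by (elim disjE; hypsubst) (simp_all only: triple_fun_simps)
  then show "m \<in> {m. inj m}" by (simp add: inj_def)
qed

lemma sum_perm_triples:
  "sum f perm_triples = f (0, 1, 2) + (f (0, 2, 1) + (f (1, 0, 2) + (f (1, 2, 0) + (f (2, 0, 1) + (f (2, 1, 0) :: nat)))))"
  unfolding perm_triples_def
  by (subst sum.insert; (simp only: distinct_3 finite.intros insert_iff empty_iff simp_thms prod.inject sum.empty add_0_right)?)+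

text \<open>The number of permutations with \<open>m a \<noteq> b\<close> and
  \<open>m a' \<noteq> b'\<close> is 3 for disjoint edges, 2 for distinct edges with a common end
  and 4 for equal edges. The parity is evaluated from the six-term sum in all cases.\<close>

lemma count_hexagons:
  "odd (card {m. inj m \<and> {(a, b), (a', b')} \<subseteq> hexagon m}) \<longleftrightarrow> a \<noteq> a' \<and> b \<noteq> b'"
proof -
  have fin: "finite {m :: 3 \<Rightarrow> 3. inj m}" by simp
  have "card {m. inj m \<and> {(a, b), (a', b')} \<subseteq> hexagon m} =
      (\<Sum>m\<in>{m. inj m}. if b \<noteq> m a \<and> b' \<noteq> m a' then 1 else 0)"
    unfolding sum.inter_filter[OF fin, symmetric] by (simp add: hexagon_def)
  also have "\<dots> = (\<Sum>t\<in>perm_triples. if b \<noteq> triple_fun t a \<and> b' \<noteq> triple_fun t a' then 1 else 0)"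
    unfolding inj_3 by (subst sum.reindex) (auto intro: inj_on_subset[OF inj_triple_fun])
  finally have card: "card {m. inj m \<and> {(a, b), (a', b')} \<subseteq> hexagon m} =
    (\<Sum>t\<in>perm_triples. if b \<noteq> triple_fun t a \<and> b' \<noteq> triple_fun t a' then 1 else 0)" .
  show ?thesis
    unfolding card sum_perm_triples
    using three_cases[of a] three_cases[of b] three_cases[of a'] three_cases[of b']
    by (elim disjE; hypsubst)
       (simp_all only: triple_fun_simps distinct_3 simp_thms if_True if_False add_0_left add_0_right
         one_add_one one_plus_numeral add_num_simps even_numeral odd_numeral)
qed

lemma square_inject: "square a b = square a' b' \<longleftrightarrow> a = a' \<and> b = b'"
proof
  assume eq: "square a b = square a' b'"
  have "- {x} \<noteq> {}" for x :: 3
    using two_others[of x] by blast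
  then have "- {a} = - {a'} \<and> - {b} = - {b'}"
    using eq unfolding square_def by (simp only: times_eq_iff) blast
  then show "a = a' \<and> b = b'" by blast
qed simp

lemma hexagon_inject: "hexagon m = hexagon m' \<longleftrightarrow> m = m'"
proof
  assume eq: "hexagon m = hexagon m'"
  show "m = m'"
  proof
    fix a
    have "(a, m' a) \<in> hexagon m \<longleftrightarrow> (a, m' a) \<in> hexagon m'" using eq by simp
    then show "m a = m' a" by (simp add: hexagon_def)
  qed
qed simp

lemma bip_graph_inject: "bip_graph C = bip_graph D \<longleftrightarrow> C = D"
  by (metis edge_pairs_bip_graph)

text \<open>Carries the two counts over to actual cycles along the injective parametrizations. Equal
  pairs are included; they stand for a crossing of an edge with itself.\<close>

lemma count_cycles:
  assumes "k \<in> {4, 6}"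
  shows "finite (cycles k K33)"
    and "odd (card {\<gamma> \<in> cycles k K33. {(a, b), (a', b')} \<subseteq> edge_pairs \<gamma>}) \<longleftrightarrow> a \<noteq> a' \<and> b \<noteq> b'"
proof -
  show "finite (cycles k K33)"
    using assms by (auto simp: cycles_4 cycles_6)
  have "{\<gamma> \<in> cycles 4 K33. {(a, b), (a', b')} \<subseteq> edge_pairs \<gamma>} =
      (\<lambda>(c, d). bip_graph (square c d)) ` {(c, d). {(a, b), (a', b')} \<subseteq> square c d}"
    unfolding cycles_4 by auto
  then have "card {\<gamma> \<in> cycles 4 K33. {(a, b), (a', b')} \<subseteq> edge_pairs \<gamma>} = card {(c, d). {(a, b), (a', b')} \<subseteq> square c d}"
    by (simp only:) (rule card_image, auto simp: inj_on_def bip_graph_inject square_inject)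
  moreover have "{\<gamma> \<in> cycles 6 K33. {(a, b), (a', b')} \<subseteq> edge_pairs \<gamma>} =
      (\<lambda>m. bip_graph (hexagon m)) ` {m. inj m \<and> {(a, b), (a', b')} \<subseteq> hexagon m}"
    unfolding cycles_6 by auto
  then have "card {\<gamma> \<in> cycles 6 K33. {(a, b), (a', b')} \<subseteq> edge_pairs \<gamma>} = card {m. inj m \<and> {(a, b), (a', b')} \<subseteq> hexagon m}"
    by (simp only:) (rule card_image, auto simp: inj_on_def bip_graph_inject hexagon_inject)
  ultimately show "odd (card {\<gamma> \<in> cycles k K33. {(a, b), (a', b')} \<subseteq> edge_pairs \<gamma>}) \<longleftrightarrow> a \<noteq> a' \<and> b \<noteq> b'"
    using assms count_squares[of a b a' b'] count_hexagons[of a b a' b'] by auto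
qed

section \<open>Crossings of a generic immersion\<close>

text \<open>Set independence in terms of coefficients, a form that survives rescaling a
  velocity.\<close>

lemma independent_pair:
  fixes a b :: "'a::real_vector"
  assumes "independent {a, b}" "a \<noteq> b" "x *\<^sub>R a + y *\<^sub>R b = 0"
  shows "x = 0 \<and> y = 0"
proof -
  let ?u = "\<lambda>v. if v = a then x else y"
  have sum: "(\<Sum>v\<in>{a, b}. ?u v *\<^sub>R v) = 0"
    using assms(2,3) by simp
  have "?u v = 0" if "v \<in> {a, b}" for v
  proof (rule ccontr)
    assume "?u v \<noteq> 0"
    with sum that have "\<exists>u. (\<exists>v\<in>{a, b}. u v \<noteq> 0) \<and> (\<Sum>v\<in>{a, b}. u v *\<^sub>R v) = 0"
      by (intro exI[of _ ?u] conjI bexI[of _ v])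
    then have "dependent {a, b}"
      by (simp only: real_vector.dependent_finite finite.intros)
    with assms(1) show False by blast
  qed
  from this[of a] this[of b] show ?thesis using assms(2) by auto
qed

abbreviation edge_map :: "3 \<Rightarrow> 3 \<Rightarrow> real \<Rightarrow> real ^ (3 + 3)" where
  "edge_map a b \<equiv> edge_path (Inl a) (Inr b)"

text \<open>Every edge can be run from left to right; reversal replaces the parameter by
  \<open>1 - s\<close> and the velocity by its negative, whence the factor \<open>c\<close>.\<close>

lemma oriented_edge:
  assumes "{u, v} \<in> edges K33" "s \<in> {0<..<1}" "((f \<circ> edge_path u v) has_vector_derivative A) (at s)"
  shows "\<exists>a b t c. t \<in> {0<..<1} \<and> edge_path u v s = edge_map a b t \<and> c \<noteq> 0 \<and>
    ((f \<circ> edge_map a b) has_vector_derivative c *\<^sub>R A) (at t)"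
  using assms(1)
proof (cases rule: edges_K33_E)
  case (1 a b)
  then show ?thesis
    using assms by (intro exI[of _ a] exI[of _ b] exI[of _ s] exI[of _ 1]) auto
next
  case (2 b a)
  have rev: "edge_map a b = edge_path u v \<circ> (\<lambda>t. 1 - t)"
    using 2 by (auto simp: edge_path_def linepath_def fun_eq_iff)
  have "((\<lambda>t. 1 - t) has_vector_derivative - 1) (at (1 - s))"
    by (auto intro!: derivative_eq_intros)
  moreover have "((f \<circ> edge_path u v) has_vector_derivative A) (at (1 - (1 - s)))"
    using assms(3) by simp
  ultimately have "((f \<circ> edge_path u v) \<circ> (\<lambda>t. 1 - t) has_vector_derivative (- 1) *\<^sub>R A) (at (1 - s))"
    by (rule vector_diff_chain_at)
  then have "((f \<circ> edge_map a b) has_vector_derivative (- 1) *\<^sub>R A) (at (1 - s))"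
    unfolding rev by (simp add: o_assoc)
  moreover have "edge_path u v s = edge_map a b (1 - s)" unfolding rev by simp
  ultimately show ?thesis
    using assms(2) by (intro exI[of _ a] exI[of _ b] exI[of _ "1 - s"] exI[of _ "-1"]) auto
qed

lemma generic_double_point:
  assumes "plane_generic_immersion K33 f" "p \<in> multiple_points f K33"
  shows "\<exists>a b s a' b' s' A B. s \<in> {0<..<1} \<and> s' \<in> {0<..<1} \<and> edge_map a b s \<noteq> edge_map a' b' s' \<and>
    {x \<in> realization K33. f x = p} = {edge_map a b s, edge_map a' b' s'} \<and>
    ((f \<circ> edge_map a b) has_vector_derivative A) (at s) \<and>
    ((f \<circ> edge_map a' b') has_vector_derivative B) (at s') \<and>
    (\<forall>x y. x *\<^sub>R A + y *\<^sub>R B = 0 \<longrightarrow> x = 0 \<and> y = 0)"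
proof -
  have "transversal_double_point f K33 p"
    using assms by (auto simp: plane_generic_immersion_def)
  then obtain u v s u' v' s' A B where
    uv: "{u, v} \<in> edges K33" "s \<in> {0<..<1}" "{u', v'} \<in> edges K33" "s' \<in> {0<..<1}"
    and ne: "edge_path u v s \<noteq> edge_path u' v' s'"
    and pre: "{x \<in> realization K33. f x = p} = {edge_path u v s, edge_path u' v' s'}"
    and der: "((f \<circ> edge_path u v) has_vector_derivative A) (at s)"
      "((f \<circ> edge_path u' v') has_vector_derivative B) (at s')"
    and ind: "A \<noteq> B" "independent {A, B}"
    unfolding transversal_double_point_def by blast
  obtain a b t c where 1: "t \<in> {0<..<1}" "edge_path u v s = edge_map a b t" "c \<noteq> 0"
    "((f \<circ> edge_map a b) has_vector_derivative c *\<^sub>R A) (at t)"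
    using oriented_edge[OF uv(1,2) der(1)] by blast
  obtain a' b' t' c' where 2: "t' \<in> {0<..<1}" "edge_path u' v' s' = edge_map a' b' t'" "c' \<noteq> 0"
    "((f \<circ> edge_map a' b') has_vector_derivative c' *\<^sub>R B) (at t')"
    using oriented_edge[OF uv(3,4) der(2)] by blast
  have "\<forall>x y. x *\<^sub>R c *\<^sub>R A + y *\<^sub>R c' *\<^sub>R B = 0 \<longrightarrow> x = 0 \<and> y = 0"
  proof (intro allI impI)
    fix x y assume eq: "x *\<^sub>R c *\<^sub>R A + y *\<^sub>R c' *\<^sub>R B = 0"
    have "x * c = 0 \<and> y * c' = 0"
      by (rule independent_pair[OF ind(2,1)]) (use eq in \<open>simp only: scaleR_scaleR\<close>)
    then show "x = 0 \<and> y = 0" using 1(3) 2(3) by (simp only: mult_eq_0_iff simp_thms)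
  qed
  note ind' = this
  show ?thesis
    by (rule exI[of _ a], rule exI[of _ b], rule exI[of _ t], rule exI[of _ a'], rule exI[of _ b'], rule exI[of _ t'],
        rule exI[of _ "c *\<^sub>R A"], rule exI[of _ "c' *\<^sub>R B"])
       (intro conjI 1(1,4) 2(1,4) ne[unfolded 1(2) 2(2)] pre[unfolded 1(2) 2(2)] ind')
qed

text \<open>The edges that pass through a crossing. At a self-crossing of an edge this set is a
  singleton.\<close>

definition branches :: "(real ^ (3 + 3) \<Rightarrow> real ^ 2) \<Rightarrow> real ^ 2 \<Rightarrow> (3 \<times> 3) set" where
  "branches f p = {(a, b). \<exists>s\<in>{0<..<1}. f (edge_map a b s) = p}"

lemma edge_map_in_realization: "0 \<le> t \<Longrightarrow> t \<le> 1 \<Longrightarrow> edge_map a b t \<in> realization K33"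
  by (rule edge_path_in_realization) (auto simp: edges_K33)

lemma branches_eq:
  assumes "{x \<in> realization K33. f x = p} = {edge_map a b s, edge_map a' b' s'}" "s \<in> {0<..<1}" "s' \<in> {0<..<1}"
  shows "branches f p = {(a, b), (a', b')}"
proof (intro equalityI subsetI)
  fix e assume "e \<in> branches f p"
  then obtain c d t where e: "e = (c, d)" "0 < t" "t < 1" "f (edge_map c d t) = p"
    by (auto simp: branches_def)
  then have "edge_map c d t \<in> {x \<in> realization K33. f x = p}"
    using edge_map_in_realization by simp
  then have "edge_map c d t = edge_map a b s \<or> edge_map c d t = edge_map a' b' s'"
    unfolding assms(1) by simp
  then show "e \<in> {(a, b), (a', b')}"
    using edge_path_inject[OF e(2,3)] e(1) by blast
next
  have "edge_map a b s \<in> {x \<in> realization K33. f x = p}" "edge_map a' b' s' \<in> {x \<in> realization K33. f x = p}"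
    unfolding assms(1) by auto
  then show "e \<in> branches f p" if "e \<in> {(a, b), (a', b')}" for e
    using that assms(2,3) by (auto simp: branches_def)
qed

lemma realization_mono:
  assumes "subgraph_of H G"
  shows "realization H \<subseteq> realization G"
  using assms unfolding realization_def subgraph_of_def by blast

text \<open>A crossing survives the restriction to \<open>H\<close> iff both of its preimages lie in
  the realization of \<open>H\<close>. Being interior to edges, they do so iff their edges belong to
  \<open>H\<close>.\<close>

lemma multiple_points_subgraph:
  assumes f: "plane_generic_immersion K33 f" and H: "subgraph_of H K33"
  shows "multiple_points f H = {p \<in> multiple_points f K33. branches f p \<subseteq> edge_pairs H}"
proof -
  have mono: "multiple_points f H \<subseteq> multiple_points f K33"
    using realization_mono[OF H] unfolding multiple_points_def by blast
  have "p \<in> multiple_points f H \<longleftrightarrow> branches f p \<subseteq> edge_pairs H" if p: "p \<in> multiple_points f K33" for p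
  proof -
    obtain a b s a' b' s' where s: "s \<in> {0<..<1}" "s' \<in> {0<..<1}" and ne: "edge_map a b s \<noteq> edge_map a' b' s'"
      and pre: "{x \<in> realization K33. f x = p} = {edge_map a b s, edge_map a' b' s'}"
      using generic_double_point[OF f p] by blast
    have br: "branches f p = {(a, b), (a', b')}" by (rule branches_eq[OF pre s])
    have iff: "edge_map a b s \<in> realization H \<longleftrightarrow> (a, b) \<in> edge_pairs H" "edge_map a' b' s' \<in> realization H \<longleftrightarrow> (a', b') \<in> edge_pairs H"
      using s by (simp_all add: edge_path_realization_iff[OF H])
    have fp: "f (edge_map a b s) = p" "f (edge_map a' b' s') = p" using pre by blast+
    have in_pre: "x = edge_map a b s \<or> x = edge_map a' b' s'" if "x \<in> realization H" "f x = p" for x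
      using that pre realization_mono[OF H] by blast
    show ?thesis
    proof
      assume "p \<in> multiple_points f H"
      then obtain x y where "x \<in> realization H" "y \<in> realization H" "x \<noteq> y" "f x = p" "f y = p"
        by (auto simp: multiple_points_def)
      then have "edge_map a b s \<in> realization H" "edge_map a' b' s' \<in> realization H"
        using in_pre by metis+
      then show "branches f p \<subseteq> edge_pairs H" using iff br by simp
    next
      assume "branches f p \<subseteq> edge_pairs H"
      then have "edge_map a b s \<in> realization H" "edge_map a' b' s' \<in> realization H" using iff br by simp_all
      then show "p \<in> multiple_points f H"
        unfolding multiple_points_def using ne fp by blast
    qed
  qed
  then show ?thesis using mono by blast
qed

section \<open>Crossings of two disjoint edges\<close>

definition coincidences :: "(real ^ (3 + 3) \<Rightarrow> real ^ 2) \<Rightarrow> 3 \<Rightarrow> 3 \<Rightarrow> 3 \<Rightarrow> 3 \<Rightarrow> (real \<times> real) set" where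
  "coincidences f a b a' b' = {(s, t). s \<in> {0..1} \<and> t \<in> {0..1} \<and> f (edge_map a b s) = f (edge_map a' b' t)}"

lemma edge_map_disjoint:
  assumes "a \<noteq> a'" "b \<noteq> b'"
  shows "edge_map a b s \<noteq> edge_map a' b' t"
proof
  assume eq: "edge_map a b s = edge_map a' b' t"
  have "edge_map a b s $ Inl a = edge_map a' b' t $ Inl a" "edge_map a b s $ Inr b = edge_map a' b' t $ Inr b"
    unfolding eq by simp_all
  then show False using assms by simp
qed

text \<open>Disjoint edges have no common point, so a coincidence is a multiple point. Its two
  preimages must be the given ones, and everything known about a transversal double point transfers
  to them.\<close>

lemma coincidence:
  assumes f: "plane_generic_immersion K33 f" and ne: "a \<noteq> a'" "b \<noteq> b'"
    and st: "(s, t) \<in> coincidences f a b a' b'"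
  shows "f (edge_map a b s) \<in> multiple_points f K33" and "s \<in> {0<..<1}" "t \<in> {0<..<1}"
    and "{x \<in> realization K33. f x = f (edge_map a b s)} = {edge_map a b s, edge_map a' b' t}"
    and "\<exists>A B. ((f \<circ> edge_map a b) has_vector_derivative A) (at s) \<and>
      ((f \<circ> edge_map a' b') has_vector_derivative B) (at t) \<and>
      (\<forall>x y. x *\<^sub>R A + y *\<^sub>R B = 0 \<longrightarrow> x = 0 \<and> y = 0)"
proof -
  define p where "p = f (edge_map a b s)"
  have s: "0 \<le> s" "s \<le> 1" "0 \<le> t" "t \<le> 1" and fp: "f (edge_map a' b' t) = p"
    using st by (auto simp: coincidences_def p_def)
  have R: "edge_map a b s \<in> realization K33" "edge_map a' b' t \<in> realization K33"
    using s by (simp_all add: edge_map_in_realization)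
  have neq: "edge_map a b s \<noteq> edge_map a' b' t" by (rule edge_map_disjoint[OF ne])
  show mp: "f (edge_map a b s) \<in> multiple_points f K33"
    unfolding multiple_points_def using R neq fp p_def by auto
  obtain c d u c' d' u' A B where u: "u \<in> {0<..<1}" "u' \<in> {0<..<1}" and
    pre: "{x \<in> realization K33. f x = p} = {edge_map c d u, edge_map c' d' u'}" and
    der: "((f \<circ> edge_map c d) has_vector_derivative A) (at u)" "((f \<circ> edge_map c' d') has_vector_derivative B) (at u')" and
    ind: "\<forall>x y. x *\<^sub>R A + y *\<^sub>R B = 0 \<longrightarrow> x = 0 \<and> y = 0"
    using generic_double_point[OF f mp[folded p_def]] by blast
  have "edge_map a b s \<in> {x \<in> realization K33. f x = p}" "edge_map a' b' t \<in> {x \<in> realization K33. f x = p}"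
    using R fp by (simp_all add: p_def)
  then have "edge_map a b s \<in> {edge_map c d u, edge_map c' d' u'}" "edge_map a' b' t \<in> {edge_map c d u, edge_map c' d' u'}"
    unfolding pre by blast+
  \<comment> \<open>The double point may list its two preimages in either order.\<close>
  then have "edge_map c d u = edge_map a b s \<and> edge_map c' d' u' = edge_map a' b' t \<or> edge_map c d u = edge_map a' b' t \<and> edge_map c' d' u' = edge_map a b s"
    using neq unfolding insert_iff empty_iff simp_thms by metis
  then consider "edge_map c d u = edge_map a b s" "edge_map c' d' u' = edge_map a' b' t" | "edge_map c d u = edge_map a' b' t" "edge_map c' d' u' = edge_map a b s"
    by blast
  then have "s \<in> {0<..<1} \<and> t \<in> {0<..<1} \<and> {x \<in> realization K33. f x = p} = {edge_map a b s, edge_map a' b' t} \<and>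
    (\<exists>A B. ((f \<circ> edge_map a b) has_vector_derivative A) (at s) \<and> ((f \<circ> edge_map a' b') has_vector_derivative B) (at t) \<and>
      (\<forall>x y. x *\<^sub>R A + y *\<^sub>R B = 0 \<longrightarrow> x = 0 \<and> y = 0))"
  proof cases
    case 1
    have "c = a" "d = b" "u = s" "c' = a'" "d' = b'" "u' = t"
      using edge_path_inject[OF _ _ 1(1)] edge_path_inject[OF _ _ 1(2)] u by auto
    then show ?thesis using u pre der ind by blast
  next
    case 2
    have eqs: "c = a'" "d = b'" "u = t" "c' = a" "d' = b" "u' = s"
      using edge_path_inject[OF _ _ 2(1)] edge_path_inject[OF _ _ 2(2)] u by auto
    have "\<forall>x y. x *\<^sub>R B + y *\<^sub>R A = 0 \<longrightarrow> x = 0 \<and> y = 0"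
      using ind by (metis add.commute)
    moreover have "{x \<in> realization K33. f x = p} = {edge_map a b s, edge_map a' b' t}"
      unfolding pre eqs by (rule insert_commute)
    ultimately show ?thesis using u der unfolding eqs by blast
  qed
  then show "s \<in> {0<..<1}" "t \<in> {0<..<1}" "{x \<in> realization K33. f x = f (edge_map a b s)} = {edge_map a b s, edge_map a' b' t}"
    "\<exists>A B. ((f \<circ> edge_map a b) has_vector_derivative A) (at s) \<and>
      ((f \<circ> edge_map a' b') has_vector_derivative B) (at t) \<and>
      (\<forall>x y. x *\<^sub>R A + y *\<^sub>R B = 0 \<longrightarrow> x = 0 \<and> y = 0)"
    by (simp_all add: p_def)
qed

text \<open>The image point has only two preimages, one on each edge, and these determine
  \<open>s\<close> and \<open>t\<close>. For the same reason \<open>s\<close> determines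
  \<open>t\<close>.\<close>

lemma coincidences_bij:
  assumes f: "plane_generic_immersion K33 f" and ne: "a \<noteq> a'" "b \<noteq> b'"
  shows "inj_on fst (coincidences f a b a' b')"
    and "bij_betw (\<lambda>(s, t). f (edge_map a b s)) (coincidences f a b a' b')
      {p \<in> multiple_points f K33. branches f p = {(a, b), (a', b')}}"
proof -
  note co = coincidence[OF f ne]
  have inj: "s = u \<and> t = v" if "(s, t) \<in> coincidences f a b a' b'" "(u, v) \<in> coincidences f a b a' b'"
    "f (edge_map a b s) = f (edge_map a b u)" for s t u v
  proof -
    have "{edge_map a b s, edge_map a' b' t} = {edge_map a b u, edge_map a' b' v}"
      using co(4)[OF that(1)] co(4)[OF that(2)] that(3) by simp
    then have "edge_map a b s = edge_map a b u" "edge_map a' b' t = edge_map a' b' v"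
      using edge_map_disjoint[OF ne] by (metis doubleton_eq_iff)+
    then show ?thesis
      using edge_path_inject(3) co(2,3)[OF that(1)] by (metis greaterThanLessThan_iff)
  qed
  then show "inj_on fst (coincidences f a b a' b')"
    by (auto simp: inj_on_def)
  show "bij_betw (\<lambda>(s, t). f (edge_map a b s)) (coincidences f a b a' b')
      {p \<in> multiple_points f K33. branches f p = {(a, b), (a', b')}}"
    unfolding bij_betw_def
  proof (intro conjI equalityI subsetI)
    show "inj_on (\<lambda>(s, t). f (edge_map a b s)) (coincidences f a b a' b')"
      using inj by (auto simp: inj_on_def)
  next
    fix p assume "p \<in> (\<lambda>(s, t). f (edge_map a b s)) ` coincidences f a b a' b'"
    then obtain s t where st: "(s, t) \<in> coincidences f a b a' b'" "p = f (edge_map a b s)" by auto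
    then show "p \<in> {p \<in> multiple_points f K33. branches f p = {(a, b), (a', b')}}"
      using co(1)[OF st(1)] branches_eq[OF co(4,2,3)[OF st(1)]] by simp
  next
    fix p assume "p \<in> {p \<in> multiple_points f K33. branches f p = {(a, b), (a', b')}}"
    then have "(a, b) \<in> branches f p" "(a', b') \<in> branches f p" by auto
    then obtain s t where "s \<in> {0<..<1}" "f (edge_map a b s) = p" "t \<in> {0<..<1}" "f (edge_map a' b' t) = p"
      unfolding branches_def by blast
    then show "p \<in> (\<lambda>(s, t). f (edge_map a b s)) ` coincidences f a b a' b'"
      by (intro image_eqI[of _ _ "(s, t)"]) (auto simp: coincidences_def)
  qed
qed

definition to_complex :: "real ^ 2 \<Rightarrow> complex" where
  "to_complex p = Complex (p $ 1) (p $ 2)"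

lemma to_complex_inject: "to_complex p = to_complex q \<longleftrightarrow> p = q"
  by (auto simp: to_complex_def vec_eq_iff forall_2)

lemma bounded_linear_to_complex: "bounded_linear to_complex"
proof -
  have "linear to_complex"
    by (rule linearI) (simp_all add: to_complex_def complex_eq_iff)
  then show ?thesis by (simp add: linear_conv_bounded_linear)
qed

lemma odd_disjoint_crossings:
  assumes f: "plane_generic_immersion K33 f"
  shows "odd (\<Sum>(a, a')\<in>lt_pairs. \<Sum>(b, b')\<in>ne_pairs. card (coincidences f a b a' b'))"
proof (rule K33_odd_crossings)
  let ?P = "\<lambda>v. to_complex (f (vertex_pt v))" and ?g = "\<lambda>a b. to_complex \<circ> (f \<circ> edge_map a b)"
  interpret to_complex: bounded_linear to_complex by (rule bounded_linear_to_complex)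
  \<comment> \<open>A vertex with the same image as another point would be a preimage of a multiple
    point, but such preimages are interior to edges.\<close>
  have vertex: "f (vertex_pt v) \<noteq> f x" if x: "x \<in> realization K33" "x \<noteq> vertex_pt v" for v x
  proof
    assume eq: "f (vertex_pt v) = f x"
    have v: "vertex_pt v \<in> realization K33"
      by (rule vertex_pt_in_realization) (simp add: K33_def complete_bipartite_def)
    then have "f x \<in> multiple_points f K33"
      unfolding multiple_points_def using x eq by blast
    from generic_double_point[OF f this] obtain a b s a' b' s' where "s \<in> {0<..<1}" "s' \<in> {0<..<1}"
      "{y \<in> realization K33. f y = f x} = {edge_map a b s, edge_map a' b' s'}"
      by blast
    moreover have "vertex_pt v \<in> {y \<in> realization K33. f y = f x}" using v eq by simp
    ultimately show False
      using edge_path_neq_vertex_pt[of s a b v] edge_path_neq_vertex_pt[of s' a' b' v] by auto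
  qed
  have vertex_pt_R: "vertex_pt v \<in> realization K33" for v
    by (rule vertex_pt_in_realization) (simp add: K33_def complete_bipartite_def)
  show "inj ?P"
    using vertex[OF vertex_pt_R] by (intro injI) (metis to_complex_inject vertex_pt_eq_iff)
  have contf: "continuous_on {0..1} (f \<circ> edge_map a b)" for a b
    using f by (auto simp: plane_generic_immersion_def plane_immersion_def piecewise_smooth_path_def edges_K33)
  have cont: "continuous_on {0..1} (?g a b)" for a b
    by (rule continuous_on_compose[OF contf]) (rule to_complex.continuous_on[OF continuous_on_id])
  show "path (?g a b)" for a b
    unfolding path_def by (rule cont)
  show "?g a b 0 = ?P (Inl a)" "?g a b 1 = ?P (Inr b)" for a b
    by simp_all
  show "?P v \<notin> path_image (?g a b)" if v: "v \<noteq> Inl a" "v \<noteq> Inr b" for a b v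
  proof
    assume "?P v \<in> path_image (?g a b)"
    then obtain s where s: "0 \<le> s" "s \<le> 1" "f (vertex_pt v) = f (edge_map a b s)"
      by (auto simp: path_image_def to_complex_inject)
    have "(edge_map a b s :: real ^ (3 + 3)) $ v \<noteq> vertex_pt v $ v"
      using v by (simp add: edge_path_nth vertex_pt_nth)
    then have "edge_map a b s \<noteq> vertex_pt v" by metis
    then show False using vertex[OF edge_map_in_realization[OF s(1,2)]] s(3) by metis
  qed
  fix a b a' b' :: 3
  assume ne: "a \<noteq> a'" "b \<noteq> b'"
  note co = coincidence[OF f ne]
  have Z: "{(s, t). s \<in> {0..1} \<and> t \<in> {0..1} \<and> ?g a b s = ?g a' b' t} = coincidences f a b a' b'"
    by (auto simp: coincidences_def to_complex_inject)
  have "\<exists>n::int. winding_number (?g a b) (?g a' b' 0) + winding_number (?g a' b') (?g a b 1) -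
      winding_number (?g a b) (?g a' b' 1) - winding_number (?g a' b') (?g a b 0) = of_int n \<and>
      (even n \<longleftrightarrow> even (card {(s, t). s \<in> {0..1} \<and> t \<in> {0..1} \<and> ?g a b s = ?g a' b' t}))"
  proof (rule crossing_parity[OF cont cont], unfold Z)
    show "finite (coincidences f a b a' b')"
    proof -
      have "finite {p \<in> multiple_points f K33. branches f p = {(a, b), (a', b')}}"
        using f by (simp add: plane_generic_immersion_def)
      then show ?thesis
        using bij_betw_finite[OF coincidences_bij(2)[OF f ne]] by simp
    qed
    show "inj_on fst (coincidences f a b a' b')"
      by (rule coincidences_bij(1)[OF f ne])
    show "coincidences f a b a' b' \<subseteq> {0<..<1} \<times> {0<..<1}"
      using co(2,3) by auto
    fix s t assume st: "(s, t) \<in> coincidences f a b a' b'"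
    obtain A B where AB: "((f \<circ> edge_map a b) has_vector_derivative A) (at s)"
      "((f \<circ> edge_map a' b') has_vector_derivative B) (at t)"
      "\<And>x y. x *\<^sub>R A + y *\<^sub>R B = 0 \<Longrightarrow> x = 0 \<and> y = 0"
      using co(5)[OF st] by blast
    have "(?g a b has_vector_derivative to_complex A) (at s)" "(?g a' b' has_vector_derivative to_complex B) (at t)"
      using to_complex.has_vector_derivative[OF AB(1)] to_complex.has_vector_derivative[OF AB(2)]
      by (simp_all add: o_def)
    moreover have "x = 0 \<and> y = 0" if "x *\<^sub>R to_complex A + y *\<^sub>R to_complex B = 0" for x y
    proof -
      have "to_complex (x *\<^sub>R A + y *\<^sub>R B) = to_complex 0"
        using that by (simp add: to_complex.add to_complex.scaleR to_complex.zero)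
      then show ?thesis using AB(3) to_complex_inject by blast
    qed
    ultimately show "\<exists>a'' b''. (?g a b has_vector_derivative a'') (at s) \<and>
      (?g a' b' has_vector_derivative b'') (at t) \<and> (\<forall>x y. x *\<^sub>R a'' + y *\<^sub>R b'' = 0 \<longrightarrow> x = 0 \<and> y = 0)"
      by blast
  qed
  then show "\<exists>n::int. winding_number (?g a b) (?P (Inl a')) + winding_number (?g a' b') (?P (Inr b)) -
      winding_number (?g a b) (?P (Inr b')) - winding_number (?g a' b') (?P (Inl a)) = of_int n \<and>
      (even n \<longleftrightarrow> even (card (coincidences f a b a' b')))"
    unfolding Z by simp
qed

section \<open>Double counting of crossings and cycles\<close>

definition disjoint_branches :: "(real ^ (3 + 3) \<Rightarrow> real ^ 2) \<Rightarrow> real ^ 2 \<Rightarrow> bool" where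
  "disjoint_branches f p \<longleftrightarrow> (\<exists>a b a' b'. a \<noteq> a' \<and> b \<noteq> b' \<and> branches f p = {(a, b), (a', b')})"

text \<open>The crossings are sorted by their set of branches. Requiring the smaller left index
  first picks one of the two orders of each pair, so the classes are disjoint and exhaust.\<close>

lemma card_disjoint_crossings:
  assumes f: "plane_generic_immersion K33 f"
  shows "card {p \<in> multiple_points f K33. disjoint_branches f p} =
    (\<Sum>(a, a')\<in>lt_pairs. \<Sum>(b, b')\<in>ne_pairs. card (coincidences f a b a' b'))"
proof -
  let ?I = "lt_pairs \<times> ne_pairs"
  define S where "S = (\<lambda>((a, a'), (b, b')). {p \<in> multiple_points f K33. branches f p = {(a, b :: 3), (a' :: 3, b')}})"
  have fin: "finite (multiple_points f K33)"
    using f by (simp add: plane_generic_immersion_def)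
  have "{p \<in> multiple_points f K33. disjoint_branches f p} = (\<Union>i\<in>?I. S i)"
  proof (intro equalityI subsetI)
    fix p assume "p \<in> {p \<in> multiple_points f K33. disjoint_branches f p}"
    then obtain a b a' b' where p: "p \<in> multiple_points f K33" "a \<noteq> a'" "b \<noteq> b'"
      "branches f p = {(a, b), (a', b')}"
      unfolding disjoint_branches_def by blast
    consider "index a < index a'" | "index a' < index a"
      using p(2) index_inject by (metis linorder_neqE_nat)
    then show "p \<in> (\<Union>i\<in>?I. S i)"
    proof cases
      case 1
      then have "((a, a'), (b, b')) \<in> ?I" using p by (simp add: lt_pairs_iff ne_pairs_iff)
      moreover have "p \<in> S ((a, a'), (b, b'))" using p by (simp add: S_def)
      ultimately show ?thesis by blast
    next
      case 2
      then have "((a', a), (b', b)) \<in> ?I" using p by (simp add: lt_pairs_iff ne_pairs_iff)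
      moreover have "p \<in> S ((a', a), (b', b))" using p by (simp add: S_def insert_commute)
      ultimately show ?thesis by blast
    qed
  next
    fix p assume "p \<in> (\<Union>i\<in>?I. S i)"
    then obtain a a' b b' where i: "(a, a') \<in> lt_pairs" "(b, b') \<in> ne_pairs" "p \<in> S ((a, a'), (b, b'))"
      by auto
    have p: "p \<in> multiple_points f K33" "branches f p = {(a, b), (a', b')}"
      using i(3) by (simp_all add: S_def)
    have "a \<noteq> a'" "b \<noteq> b'"
      using i(1,2) unfolding lt_pairs_iff ne_pairs_iff by blast+
    with p(2) have "disjoint_branches f p"
      unfolding disjoint_branches_def by (intro exI conjI)
    with p(1) show "p \<in> {p \<in> multiple_points f K33. disjoint_branches f p}"
      by (intro CollectI conjI)
  qed
  also have "card (\<Union>i\<in>?I. S i) = (\<Sum>i\<in>?I. card (S i))"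
  proof (rule card_UN_disjoint)
    show "finite ?I" by (simp add: lt_pairs_def ne_pairs_def)
    show "\<forall>i\<in>?I. finite (S i)" using fin by (auto simp: S_def)
    show "\<forall>i\<in>?I. \<forall>j\<in>?I. i \<noteq> j \<longrightarrow> S i \<inter> S j = {}"
    proof (intro ballI impI)
      fix i j assume ij: "i \<in> ?I" "j \<in> ?I" "i \<noteq> j"
      obtain a a' b b' where i: "i = ((a, a'), (b, b'))" by (metis surj_pair)
      obtain c c' d d' where j: "j = ((c, c'), (d, d'))" by (metis surj_pair)
      have lt: "index a < index a'" "index c < index c'"
        using ij(1,2) unfolding i j by (simp_all add: lt_pairs_iff)
      have ne: "{(a, b), (a', b')} \<noteq> {(c, d), (c', d')}"
      proof
        assume "{(a, b), (a', b')} = {(c, d), (c', d')}"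
        then have "(a, b) = (c, d) \<and> (a', b') = (c', d') \<or> (a, b) = (c', d') \<and> (a', b') = (c, d)"
          by (simp only: doubleton_eq_iff)
        then show False
        proof (elim disjE conjE)
          assume "(a, b) = (c, d)" "(a', b') = (c', d')"
          then have "i = j" unfolding i j by simp
          with ij(3) show False by contradiction
        next
          \<comment> \<open>A match with the two edges exchanged would reverse the order of the left
            indices.\<close>
          assume "(a, b) = (c', d')" "(a', b') = (c, d)"
          then have "a = c'" "a' = c" by simp_all
          with lt show False by simp
        qed
      qed
      show "S i \<inter> S j = {}"
      proof (rule equals0I)
        fix p assume "p \<in> S i \<inter> S j"
        then have "branches f p = {(a, b), (a', b')} \<and> branches f p = {(c, d), (c', d')}"
          unfolding S_def i j prod.case Int_iff mem_Collect_eq by (elim conjE) (intro conjI)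
        with ne show False by metis
      qed
    qed
  qed
  also have "\<dots> = (\<Sum>i\<in>lt_pairs. \<Sum>j\<in>ne_pairs. card (S (i, j)))"
    by (simp add: sum.cartesian_product case_prod_unfold)
  also have "\<dots> = (\<Sum>(a, a')\<in>lt_pairs. \<Sum>(b, b')\<in>ne_pairs. card (coincidences f a b a' b'))"
  proof (intro sum.cong refl)
    fix i assume "i \<in> lt_pairs"
    then obtain a a' where i: "i = (a, a')" "a \<noteq> a'" by (cases i) (auto simp: lt_pairs_iff)
    have "card (S (i, j)) = (case j of (b, b') \<Rightarrow> card (coincidences f a b a' b'))" if j_in: "j \<in> ne_pairs" for j
    proof -
      obtain b b' where j: "j = (b, b')" "b \<noteq> b'" using j_in by (cases j) (auto simp: ne_pairs_iff)
      show ?thesis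
        using bij_betw_same_card[OF coincidences_bij(2)[OF f i(2) j(2)]] by (simp add: i j S_def)
    qed
    then show "(\<Sum>j\<in>ne_pairs. card (S (i, j))) =
        (case i of (a, a') \<Rightarrow> \<Sum>(b, b')\<in>ne_pairs. card (coincidences f a b a' b'))"
      unfolding i(1) prod.case by (intro sum.cong refl) (simp add: i(1))
  qed
  finally show ?thesis .
qed

text \<open>Exchanging the sums, each crossing is counted once for every \<open>k\<close>-cycle
  containing its branches. Modulo 2 only the crossings of disjoint edges remain, and their number is
  odd.\<close>

lemma sum_crossing_number_odd:
  assumes f: "plane_generic_immersion K33 f" and k: "k \<in> {4, 6}"
  shows "odd (\<Sum>\<gamma>\<in>cycles k K33. crossing_number f \<gamma>)"
proof -
  let ?M = "multiple_points f K33"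
  have fin: "finite ?M" using f by (simp add: plane_generic_immersion_def)
  have "(\<Sum>\<gamma>\<in>cycles k K33. crossing_number f \<gamma>) = (\<Sum>\<gamma>\<in>cycles k K33. card {p \<in> ?M. branches f p \<subseteq> edge_pairs \<gamma>})"
    by (intro sum.cong refl) (simp add: crossing_number_def multiple_points_subgraph[OF f cycles_subgraph])
  also have "\<dots> = (\<Sum>p\<in>?M. card {\<gamma> \<in> cycles k K33. branches f p \<subseteq> edge_pairs \<gamma>})"
    by (rule sum_multicount_gen) (use fin count_cycles(1)[OF k] in auto)
  finally have sum: "(\<Sum>\<gamma>\<in>cycles k K33. crossing_number f \<gamma>) =
    (\<Sum>p\<in>?M. card {\<gamma> \<in> cycles k K33. branches f p \<subseteq> edge_pairs \<gamma>})" .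
  have "odd (card {\<gamma> \<in> cycles k K33. branches f p \<subseteq> edge_pairs \<gamma>}) \<longleftrightarrow> disjoint_branches f p" if p: "p \<in> ?M" for p
  proof -
    obtain a b s a' b' s' where "s \<in> {0<..<1}" "s' \<in> {0<..<1}"
      "{x \<in> realization K33. f x = p} = {edge_map a b s, edge_map a' b' s'}"
      using generic_double_point[OF f p] by blast
    then have br: "branches f p = {(a, b), (a', b')}" using branches_eq by blast
    have "disjoint_branches f p \<longleftrightarrow> a \<noteq> a' \<and> b \<noteq> b'"
      unfolding disjoint_branches_def br doubleton_eq_iff prod.inject by blast
    then show ?thesis using count_cycles(2)[OF k, of a b a' b'] br by simp
  qed
  then have "{p \<in> ?M. odd (card {\<gamma> \<in> cycles k K33. branches f p \<subseteq> edge_pairs \<gamma>})} = {p \<in> ?M. disjoint_branches f p}"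
    by blast
  then show ?thesis
    unfolding sum even_sum_iff[OF fin]
    using odd_disjoint_crossings[OF f] card_disjoint_crossings[OF f] by simp
qed

theorem theorem1p2:
  fixes f :: "real ^ (3 + 3) \<Rightarrow> real ^ 2"
  assumes "plane_generic_immersion K33 f"
  shows "[(\<Sum>\<gamma>\<in>cycles 4 K33. crossing_number f \<gamma>) =
          (\<Sum>\<gamma>\<in>cycles 6 K33. crossing_number f \<gamma>)] (mod 2) \<and>
         [(\<Sum>\<gamma>\<in>cycles 6 K33. crossing_number f \<gamma>) = 1] (mod 2)"
  using sum_crossing_number_odd[OF assms, of 4] sum_crossing_number_odd[OF assms, of 6]
  by (simp add: cong_def odd_iff_mod_2_eq_one)

end
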